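(* There exists an SSP problem instance $M=(S,A,P,c,s_{\mathrm{init}})$ in which $J^{\pi^\star}(s)\le B_\star$ for all $s\in S$, $|S|\ge2$, $|A|\ge16$, $B_\star\ge2$, $K\ge|S||A|$, and $c(s,a)=1$ for all $s\in S$, $a\in A$, such that the expected regret of any learner after $K$ episodes satisfies $$\mathbb E[R_K]\ge\frac1{1024}\,B_\star\sqrt{|S||A|K}.$$
   Context: A stochastic shortest path (SSP) instance is $M=(S,A,P,c,s_{\mathrm{init}})$ with finite state set $S$, finite action set $A$, initial state $s_{\mathrm{init}}$, a goal state $g\notin S$, costs $c(s,a)\in[0,1]$ and a transition function $P$: playing $a$ in $s$ costs $c(s,a)$ and leads to $s'\in S$ with probability $P(s'\mid s,a)$ and to $g$ with probability $1-\sum_{s'\in S}P(s'\mid s,a)$. A (stationary deterministic) policy $\pi:S\to A$ is proper if it reaches $g$ with probability $1$ from every state; at least one proper policy is assumed to exist. $J^\pi(s)$ is the expected total cost of $\pi$ from $s$ until reaching $g$, and $\pi^\star$ is the optimal proper policy (it minimizes $J^\pi(s)$ over proper $\pi$ simultaneously for all $s\in S$). A learner knows the costs but not $P$, and plays $K$ episodes, each starting at $s_{\mathrm{init}}$ and ending when $g$ is reached. With $(s_i^k,a_i^k)$ the $i$-th state-action pair of episode $k$ and $I^k$ the (possibly infinite) length of episode $k$, the regret is $R_K=\sum_{k=1}^K\sum_{i=1}^{I^k}c(s_i^k,a_i^k)-K\cdot J^{\pi^\star}(s_{\mathrm{init}})$, with $R_K=\infty$ if some $I^k=\infty$.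
   Formalization: The instance may depend on the learner: for all |S|, |A|, B⋆, K in the stated ranges and every learner there is such an instance. One instance for all learners is impossible, since a learner that always plays its optimal policy has expected regret 0. *)

theory Defs
  imports "HOL-Probability.Probability"
begin

text \<open>
  The state set and the action set are finite types. The goal is the outcome
  \<^const>\<open>None\<close> of a transition: \<open>trans M s a\<close> gives \<open>Some s'\<close> with probability \<open>P(s' | s, a)\<close>
  and \<^const>\<open>None\<close> with the remaining mass.
\<close>

record ('s, 'a) ssp =
  trans :: "'s \<Rightarrow> 'a \<Rightarrow> 's spmf"
  cost :: "'s \<Rightarrow> 'a \<Rightarrow> real"
  init :: 's

type_synonym ('s, 'a) step = "'s \<times> 'a \<times> 's option"

text \<open>
  A learner maps the list of all steps observed so far (over all episodes, oldest first) and
  the current state to a distribution over actions. It does not take the instance as an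
  argument; whatever it may know in advance (costs, initial state, number of episodes) is
  fixed before it is chosen.
\<close>

type_synonym ('s, 'a) learner = "('s, 'a) step list \<Rightarrow> 's \<Rightarrow> 'a pmf"

definition policy_learner :: "('s \<Rightarrow> 'a) \<Rightarrow> ('s, 'a) learner" where
  "policy_learner \<pi> = (\<lambda>_ s. return_pmf (\<pi> s))"

definition step_state :: "(nat \<Rightarrow> ('s, 'a) step) \<Rightarrow> nat \<Rightarrow> 's" where
  "step_state \<omega> t = fst (\<omega> t)"

definition step_action :: "(nat \<Rightarrow> ('s, 'a) step) \<Rightarrow> nat \<Rightarrow> 'a" where
  "step_action \<omega> t = fst (snd (\<omega> t))"

definition step_outcome :: "(nat \<Rightarrow> ('s, 'a) step) \<Rightarrow> nat \<Rightarrow> 's option" where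
  "step_outcome \<omega> t = snd (snd (\<omega> t))"

text \<open>
  The episodes are concatenated into one infinite run: whenever the goal is reached, the next
  step starts from \<open>s\<^sub>1\<close> again. The run goes on after the last episode of interest; what happens
  there enters neither the regret nor the cost-to-go.
\<close>

definition current_state :: "'s \<Rightarrow> (nat \<Rightarrow> ('s, 'a) step) \<Rightarrow> nat \<Rightarrow> 's" where
  "current_state s\<^sub>1 \<omega> t =
     (case t of 0 \<Rightarrow> s\<^sub>1
      | Suc u \<Rightarrow> (case step_outcome \<omega> u of None \<Rightarrow> s\<^sub>1 | Some s' \<Rightarrow> s'))"

definition step_pmf ::
    "('s, 'a) ssp \<Rightarrow> ('s, 'a) learner \<Rightarrow> 's \<Rightarrow> nat \<Rightarrow> (nat \<Rightarrow> ('s, 'a) step) \<Rightarrow> ('s, 'a) step pmf" where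
  "step_pmf M L s\<^sub>1 t \<omega> =
     (let s = current_state s\<^sub>1 \<omega> t in
      bind_pmf (L (map \<omega> [0..<t]) s) (\<lambda>a. map_pmf (\<lambda>y. (s, a, y)) (trans M s a)))"

abbreviation step_kernel ::
    "('s, 'a) ssp \<Rightarrow> ('s, 'a) learner \<Rightarrow> 's \<Rightarrow> nat \<Rightarrow> (nat \<Rightarrow> ('s, 'a) step) \<Rightarrow> ('s, 'a) step measure" where
  "step_kernel M L s\<^sub>1 \<equiv> (\<lambda>t \<omega>. measure_pmf (step_pmf M L s\<^sub>1 t \<omega>))"

text \<open>The law of the infinite run, by the Ionescu-Tulcea construction from the step kernels.\<close>

definition run ::
    "('s::finite, 'a::finite) ssp \<Rightarrow> ('s, 'a) learner \<Rightarrow> 's \<Rightarrow> (nat \<Rightarrow> ('s, 'a) step) measure" where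
  "run M L s\<^sub>1 =
     projective_family.lim UNIV
       (Ionescu_Tulcea.CI (step_kernel M L s\<^sub>1) (\<lambda>_. count_space UNIV))
       (\<lambda>_. count_space UNIV)"

lemma Ionescu_Tulcea_step_kernel:
  fixes M :: "('s::finite, 'a::finite) ssp"
  shows "Ionescu_Tulcea (step_kernel M L s\<^sub>1) (\<lambda>_. count_space UNIV)"
proof
  fix i :: nat
  have eq: "PiM {0..<i} (\<lambda>_. count_space (UNIV :: ('s, 'a) step set)) =
      count_space (PiE {0..<i} (\<lambda>_. UNIV))"
    by (intro count_space_PiM_finite) simp_all
  show "step_kernel M L s\<^sub>1 i \<in>
      measurable (PiM {0..<i} (\<lambda>_. count_space UNIV)) (subprob_algebra (count_space UNIV))"
    unfolding eq measurable_count_space_eq1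
    by (auto simp: space_subprob_algebra measure_pmf.subprob_space_axioms)
qed

lemma distr_run_restrict:
  fixes M :: "('s::finite, 'a::finite) ssp"
  assumes "finite J"
  shows "distr (run M L s\<^sub>1) (PiM J (\<lambda>_. count_space UNIV)) (\<lambda>\<omega>. restrict \<omega> J) =
    Ionescu_Tulcea.CI (step_kernel M L s\<^sub>1) (\<lambda>_. count_space UNIV) J"
  unfolding run_def
  by (rule Ionescu_Tulcea.distr_lim[OF Ionescu_Tulcea_step_kernel assms])

lemma sets_run: "sets (run M L s\<^sub>1) = sets (PiM UNIV (\<lambda>_. count_space UNIV))"
proof -
  interpret IT: Ionescu_Tulcea "step_kernel M L s\<^sub>1" "\<lambda>_. count_space UNIV"
    by (rule Ionescu_Tulcea_step_kernel)
  show ?thesis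
    unfolding run_def by (rule IT.PF.sets_lim)
qed

lemma prob_space_run: "prob_space (run M L s\<^sub>1)"
proof -
  interpret IT: Ionescu_Tulcea "step_kernel M L s\<^sub>1" "\<lambda>_. count_space UNIV"
    by (rule Ionescu_Tulcea_step_kernel)
  have "prob_space (distr (run M L s\<^sub>1) (PiM {} (\<lambda>_. count_space UNIV)) (\<lambda>\<omega>. restrict \<omega> {}))"
    by (subst distr_run_restrict) (auto intro: IT.PF.prob_space_P)
  then show ?thesis
    by (rule prob_space_distrD[rotated])
       (auto simp: measurable_cong_sets[OF sets_run refl] intro!: measurable_restrict)
qed

text \<open>Episodes are numbered from \<open>0\<close>: step \<open>t\<close> belongs to the episode whose index is the number of
  goal visits before \<open>t\<close>. An episode is unfinished iff its set of steps is infinite; later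
  episodes then have no steps.\<close>

definition episode_of :: "(nat \<Rightarrow> ('s, 'a) step) \<Rightarrow> nat \<Rightarrow> nat" where
  "episode_of \<omega> t = card {u. u < t \<and> step_outcome \<omega> u = None}"

definition episode_steps :: "(nat \<Rightarrow> ('s, 'a) step) \<Rightarrow> nat \<Rightarrow> nat set" where
  "episode_steps \<omega> k = {t. episode_of \<omega> t = k}"

definition step_cost :: "('s, 'a) ssp \<Rightarrow> (nat \<Rightarrow> ('s, 'a) step) \<Rightarrow> nat \<Rightarrow> real" where
  "step_cost M \<omega> t = cost M (step_state \<omega> t) (step_action \<omega> t)"

definition proper :: "('s::finite, 'a::finite) ssp \<Rightarrow> ('s \<Rightarrow> 'a) \<Rightarrow> bool" where
  "proper M \<pi> \<longleftrightarrow>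
     (\<forall>s. AE \<omega> in run M (policy_learner \<pi>) s. \<exists>t. step_outcome \<omega> t = None)"

definition ssp_instance :: "('s::finite, 'a::finite) ssp \<Rightarrow> bool" where
  "ssp_instance M \<longleftrightarrow> (\<forall>s a. 0 \<le> cost M s a \<and> cost M s a \<le> 1) \<and> (\<exists>\<pi>. proper M \<pi>)"

definition cost_to_go :: "('s::finite, 'a::finite) ssp \<Rightarrow> ('s \<Rightarrow> 'a) \<Rightarrow> 's \<Rightarrow> ennreal" where
  "cost_to_go M \<pi> s =
     (\<integral>\<^sup>+\<omega>. (\<Sum>t. if t \<in> episode_steps \<omega> 0 then ennreal (step_cost M \<omega> t) else 0)
        \<partial>run M (policy_learner \<pi>) s)"

definition optimal_proper_policy :: "('s::finite, 'a::finite) ssp \<Rightarrow> ('s \<Rightarrow> 'a) \<Rightarrow> bool" where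
  "optimal_proper_policy M \<pi> \<longleftrightarrow>
     proper M \<pi> \<and> (\<forall>\<pi>'. proper M \<pi>' \<longrightarrow> (\<forall>s. cost_to_go M \<pi> s \<le> cost_to_go M \<pi>' s))"

text \<open>The comparator is passed as a policy, to be instantiated with an optimal proper one.\<close>

definition regret ::
    "('s::finite, 'a::finite) ssp \<Rightarrow> ('s \<Rightarrow> 'a) \<Rightarrow> nat \<Rightarrow> (nat \<Rightarrow> ('s, 'a) step) \<Rightarrow> ereal" where
  "regret M \<pi>s K \<omega> =
     (if \<exists>k<K. infinite (episode_steps \<omega> k) then \<infinity>
      else ereal (\<Sum>k<K. \<Sum>t\<in>episode_steps \<omega> k. step_cost M \<omega> t)
             - ereal (real K) * enn2ereal (cost_to_go M \<pi>s (init M)))"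

text \<open>The expectation of an extended-real random variable as the difference of the expectations of
  its positive and negative parts (\<^const>\<open>e2ennreal\<close> maps negative values to \<open>0\<close>). The regret is
  bounded below as soon as the cost-to-go of the comparator is finite, so that the negative part
  is then finite.\<close>

definition ereal_expectation :: "'w measure \<Rightarrow> ('w \<Rightarrow> ereal) \<Rightarrow> ereal" where
  "ereal_expectation N X =
     enn2ereal (\<integral>\<^sup>+\<omega>. e2ennreal (X \<omega>) \<partial>N) - enn2ereal (\<integral>\<^sup>+\<omega>. e2ennreal (- X \<omega>) \<partial>N)"

definition expected_regret ::
    "('s::finite, 'a::finite) ssp \<Rightarrow> ('s \<Rightarrow> 'a) \<Rightarrow> ('s, 'a) learner \<Rightarrow> nat \<Rightarrow> ereal" where
  "expected_regret M \<pi>s L K = ereal_expectation (run M L (init M)) (regret M \<pi>s K)"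

end

theory Submission
  imports Defs
begin

text \<open>
  Every action leads to the goal with probability \<open>1 / B\<close> or \<open>(1 - \<delta>) / B\<close> and otherwise to a
  uniformly random state other than the initial one. In the initial state all actions have the
  larger probability, in any other state \<open>s\<close> only a hidden action \<open>f s\<close> does. The optimal cost to go is
  then \<open>B\<close> everywhere, and each play of another action outside the initial state adds exactly \<open>\<delta>\<close> to
  the expected regret. Over about \<open>K * B / 8\<close> steps no state is visited much more often than the
  others, whatever the learner does, and with \<open>\<delta>\<close> of order \<open>sqrt (S * A / K)\<close> the observations in \<open>s\<close> carry
  too little information to find \<open>f s\<close>: averaged over \<open>f\<close>, a constant fraction of the steps is bad.
  This is seen by comparing the instance of \<open>f\<close> with the one that has no special action in \<open>s\<close>.
\<close>

section \<open>The law of finite histories\<close>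

definition state_after :: "'s \<Rightarrow> ('s, 'a) step list \<Rightarrow> 's" where
  "state_after s\<^sub>1 h =
     (if h = [] then s\<^sub>1 else case snd (snd (last h)) of None \<Rightarrow> s\<^sub>1 | Some s' \<Rightarrow> s')"

definition next_step ::
    "('s, 'a) ssp \<Rightarrow> ('s, 'a) learner \<Rightarrow> 's \<Rightarrow> ('s, 'a) step list \<Rightarrow> ('s, 'a) step pmf" where
  "next_step M L s\<^sub>1 h =
     (let s = state_after s\<^sub>1 h in
      bind_pmf (L h s) (\<lambda>a. map_pmf (\<lambda>y. (s, a, y)) (trans M s a)))"

text \<open>Over finite types this law has finite support, so expectations under it are finite sums,
  free of the measurability questions raised by \<open>run\<close>.\<close>

primrec history ::
    "('s, 'a) ssp \<Rightarrow> ('s, 'a) learner \<Rightarrow> 's \<Rightarrow> nat \<Rightarrow> ('s, 'a) step list pmf" where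
  "history M L s\<^sub>1 0 = return_pmf []"
| "history M L s\<^sub>1 (Suc n) =
     bind_pmf (history M L s\<^sub>1 n) (\<lambda>h. map_pmf (\<lambda>x. h @ [x]) (next_step M L s\<^sub>1 h))"

abbreviation first_steps :: "(nat \<Rightarrow> 'b) \<Rightarrow> nat \<Rightarrow> 'b list" where
  "first_steps \<omega> n \<equiv> map \<omega> [0..<n]"

lemma state_after_prefix: "state_after s\<^sub>1 (first_steps \<omega> t) = current_state s\<^sub>1 \<omega> t"
  by (cases t) (auto simp: state_after_def current_state_def step_outcome_def)

lemma step_pmf_eq_next_step: "step_pmf M L s\<^sub>1 t \<omega> = next_step M L s\<^sub>1 (first_steps \<omega> t)"
  unfolding step_pmf_def next_step_def state_after_prefix ..

text \<open>The composition \<open>C\<close> extends by one kernel at a time, which on lists means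
  appending one step. \<open>g\<close> stays arbitrary because the induction hypothesis is applied
  to the inner integral over the last step.\<close>

lemma nn_integral_C_history:
  fixes M :: "('s::finite, 'a::finite) ssp" and g :: "('s, 'a) step list \<Rightarrow> ennreal"
  shows "(\<integral>\<^sup>+x. g (first_steps x n) \<partial>Ionescu_Tulcea.C (step_kernel M L s\<^sub>1) (\<lambda>_. count_space UNIV) 0 n (\<lambda>_. undefined))
     = (\<integral>\<^sup>+h. g h \<partial>history M L s\<^sub>1 n)"
proof (induction n arbitrary: g)
  interpret IT: Ionescu_Tulcea "step_kernel M L s\<^sub>1" "\<lambda>_. count_space UNIV"
    by (rule Ionescu_Tulcea_step_kernel)
  have space0: "(\<lambda>_. undefined) \<in> space (PiM {0..<0::nat} (\<lambda>_. count_space (UNIV :: ('s,'a) step set)))"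
    by (auto simp: space_PiM)
  have PiM_eq: "PiM {0..<i} (\<lambda>_. count_space (UNIV :: ('s, 'a) step set)) =
      count_space (PiE {0..<i} (\<lambda>_. UNIV))" for i :: nat
    by (intro count_space_PiM_finite) simp_all
  {
    case 0
    show ?case
      by (auto simp: nn_integral_return PiM_eq)
  next
    case (Suc n)
    have "(\<integral>\<^sup>+x. g (first_steps x (Suc n)) \<partial>IT.C 0 (Suc n) (\<lambda>_. undefined)) =
      (\<integral>\<^sup>+x. \<integral>\<^sup>+y. g (first_steps y (Suc n)) \<partial>IT.eP n x \<partial>IT.C 0 n (\<lambda>_. undefined))"
      unfolding IT.C.simps
      apply (subst nn_integral_bind[where B="PiM {0..<Suc n} (\<lambda>_. count_space UNIV)"])
      using space0 IT.measurable_eP[of n]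
      by (auto simp: PiM_eq measurable_cong_sets[OF IT.sets_C[OF space0] refl])
    also have "\<dots> = (\<integral>\<^sup>+x. \<integral>\<^sup>+y. g (first_steps x n @ [y]) \<partial>next_step M L s\<^sub>1 (first_steps x n) \<partial>IT.C 0 n (\<lambda>_. undefined))"
    proof (rule nn_integral_cong)
      fix x assume "x \<in> space (IT.C 0 n (\<lambda>_. undefined))"
      then have x: "x \<in> space (PiM {0..<n} (\<lambda>_. count_space UNIV))"
        using IT.space_C[OF space0, of n] by simp
      have "(\<integral>\<^sup>+y. g (first_steps y (Suc n)) \<partial>IT.eP n x) =
          (\<integral>\<^sup>+y. g (first_steps (x(n := y)) (Suc n)) \<partial>step_pmf M L s\<^sub>1 n x)"
        by (rule IT.nn_integral_eP[OF x]) (auto simp: PiM_eq)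
      moreover have "first_steps (x(n := y)) (Suc n) = first_steps x n @ [y]" for y
        by auto
      ultimately show "(\<integral>\<^sup>+y. g (first_steps y (Suc n)) \<partial>IT.eP n x) =
          (\<integral>\<^sup>+y. g (first_steps x n @ [y]) \<partial>next_step M L s\<^sub>1 (first_steps x n))"
        by (simp add: step_pmf_eq_next_step)
    qed
    also have "\<dots> = (\<integral>\<^sup>+h. \<integral>\<^sup>+y. g (h @ [y]) \<partial>next_step M L s\<^sub>1 h \<partial>history M L s\<^sub>1 n)"
      by (rule Suc.IH)
    also have "\<dots> = (\<integral>\<^sup>+h. g h \<partial>history M L s\<^sub>1 (Suc n))"
      by (simp add: nn_integral_bind_pmf nn_integral_map_pmf)
    finally show ?case .
  }
qed

section \<open>Transfer of expectations from the infinite run to finite histories\<close>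

lemma measurable_prefix:
  fixes M :: "('s::finite, 'a::finite) ssp"
  shows "(\<lambda>\<omega>. first_steps \<omega> n) \<in> measurable (run M L s\<^sub>1) (count_space UNIV)"
proof -
  let ?R = "\<lambda>\<omega>. restrict \<omega> {0..<n} :: nat \<Rightarrow> ('s, 'a) step"
  have eq: "(\<lambda>\<omega>. first_steps \<omega> n) = (\<lambda>x. first_steps x n) \<circ> ?R"
    by (auto simp: fun_eq_iff)
  have "?R \<in> measurable (run M L s\<^sub>1) (PiM {0..<n} (\<lambda>_. count_space UNIV))"
    by (auto simp: measurable_cong_sets[OF sets_run refl] intro!: measurable_restrict)
  moreover have "(\<lambda>x. first_steps x n) \<in>
      measurable (PiM {0..<n} (\<lambda>_. count_space (UNIV :: ('s, 'a) step set))) (count_space UNIV)"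
    by (simp add: count_space_PiM_finite)
  ultimately show ?thesis
    by (subst eq) (rule measurable_comp)
qed

lemma nn_integral_run_prefix:
  fixes M :: "('s::finite, 'a::finite) ssp" and g :: "('s, 'a) step list \<Rightarrow> ennreal"
  shows "(\<integral>\<^sup>+\<omega>. g (first_steps \<omega> n) \<partial>run M L s\<^sub>1) = (\<integral>\<^sup>+h. g h \<partial>history M L s\<^sub>1 n)"
proof -
  interpret IT: Ionescu_Tulcea "step_kernel M L s\<^sub>1" "\<lambda>_. count_space UNIV"
    by (rule Ionescu_Tulcea_step_kernel)
  have space0: "(\<lambda>_. undefined) \<in> space (PiM {0..<0::nat} (\<lambda>_. count_space (UNIV :: ('s,'a) step set)))"
    by (auto simp: space_PiM)
  have PiM_eq: "PiM {0..<n} (\<lambda>_. count_space (UNIV :: ('s, 'a) step set)) =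
      count_space (PiE {0..<n} (\<lambda>_. UNIV))"
    by (intro count_space_PiM_finite) simp_all
  \<comment> \<open>\<open>CI\<close> projects from the first \<open>up_to\<close> steps; for an
    initial segment this projection discards nothing.\<close>
  have up: "IT.up_to {0..<n} = n"
  proof (rule antisym)
    show "IT.up_to {0..<n} \<le> n"
      by (simp add: IT.up_to_iff)
    show "n \<le> IT.up_to {0..<n}"
      using IT.up_to[of "{0..<n}"] by (cases n) (auto simp: ivl_subset)
  qed
  let ?R = "\<lambda>\<omega>. restrict \<omega> {0..<n} :: nat \<Rightarrow> ('s, 'a) step"
  have pr: "first_steps (?R \<omega>) n = first_steps \<omega> n" for \<omega>
    by auto
  have "(\<integral>\<^sup>+\<omega>. g (first_steps \<omega> n) \<partial>run M L s\<^sub>1) = (\<integral>\<^sup>+x. g (first_steps x n) \<partial>IT.CI {0..<n})"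
    unfolding distr_run_restrict[of "{0..<n}", symmetric, OF finite_atLeastLessThan]
    apply (subst nn_integral_distr)
    by (auto simp: measurable_cong_sets[OF sets_run refl] PiM_eq[symmetric] pr simp del: restrict_apply map_eq_conv intro!: measurable_restrict)
       (auto simp: PiM_eq)
  also have "\<dots> = (\<integral>\<^sup>+x. g (first_steps x n) \<partial>IT.C 0 n (\<lambda>_. undefined))"
    unfolding IT.CI_def up
    apply (subst nn_integral_distr)
    by (auto simp: measurable_cong_sets[OF IT.sets_C[OF space0] refl] PiM_eq[symmetric] pr simp del: restrict_apply map_eq_conv intro!: measurable_restrict)
       (auto simp: PiM_eq)
  also have "\<dots> = (\<integral>\<^sup>+h. g h \<partial>history M L s\<^sub>1 n)"
    by (rule nn_integral_C_history)
  finally show ?thesis .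
qed

lemma distr_run_prefix:
  fixes M :: "('s::finite, 'a::finite) ssp"
  shows "distr (run M L s\<^sub>1) (count_space UNIV) (\<lambda>\<omega>. first_steps \<omega> n) = history M L s\<^sub>1 n"
proof (rule measure_eqI)
  fix X assume "X \<in> sets (distr (run M L s\<^sub>1) (count_space UNIV) (\<lambda>\<omega>. first_steps \<omega> n))"
  show "emeasure (distr (run M L s\<^sub>1) (count_space UNIV) (\<lambda>\<omega>. first_steps \<omega> n)) X = emeasure (history M L s\<^sub>1 n) X"
    using nn_integral_run_prefix[of M L s\<^sub>1 "indicator X" n]
    by (simp add: nn_integral_distr[OF measurable_prefix, symmetric])
qed simp

lemma integral_run_prefix:
  fixes M :: "('s::finite, 'a::finite) ssp" and F :: "('s, 'a) step list \<Rightarrow> real"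
  shows "(\<integral>\<omega>. F (first_steps \<omega> n) \<partial>run M L s\<^sub>1) = measure_pmf.expectation (history M L s\<^sub>1 n) F"
  unfolding distr_run_prefix[symmetric] by (subst integral_distr[OF measurable_prefix]) auto

lemma length_history: "h \<in> set_pmf (history M L s\<^sub>1 n) \<Longrightarrow> length h = n"
  by (induction n arbitrary: h) auto

lemma finite_set_history:
  fixes M :: "('s::finite, 'a::finite) ssp"
  shows "finite (set_pmf (history M L s\<^sub>1 n))"
  using finite_lists_length_eq[of "UNIV :: ('s, 'a) step set" n]
  by (rule rev_finite_subset) (auto simp: length_history)

lemma integrable_history:
  fixes M :: "('s::finite, 'a::finite) ssp" and F :: "('s, 'a) step list \<Rightarrow> real"
  shows "integrable (measure_pmf (history M L s\<^sub>1 n)) F"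
  by (rule integrable_measure_pmf_finite[OF finite_set_history])

lemma integrable_next_step:
  fixes M :: "('s::finite, 'a::finite) ssp" and G :: "('s, 'a) step \<Rightarrow> real"
  shows "integrable (measure_pmf (next_step M L s\<^sub>1 h)) G"
  by (rule integrable_measure_pmf_finite) simp

lemma expectation_history_mono:
  fixes M :: "('s::finite, 'a::finite) ssp" and F :: "('s, 'a) step list \<Rightarrow> real"
  assumes "\<And>h. h \<in> set_pmf (history M L s\<^sub>1 n) \<Longrightarrow> F h \<le> G h"
  shows "measure_pmf.expectation (history M L s\<^sub>1 n) F \<le> measure_pmf.expectation (history M L s\<^sub>1 n) G"
  using assms by (intro integral_mono_AE integrable_history) (auto simp: AE_measure_pmf_iff)

declare history.simps(2) [simp del]

lemma expectation_history_0 [simp]: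
  fixes F :: "('s, 'a) step list \<Rightarrow> real"
  shows "measure_pmf.expectation (history M L s\<^sub>1 0) F = F []"
  by simp

lemma expectation_history_Suc:
  fixes M :: "('s::finite, 'a::finite) ssp" and F :: "('s, 'a) step list \<Rightarrow> real"
  shows "measure_pmf.expectation (history M L s\<^sub>1 (Suc n)) F =
    measure_pmf.expectation (history M L s\<^sub>1 n)
      (\<lambda>h. measure_pmf.expectation (next_step M L s\<^sub>1 h) (\<lambda>x. F (h @ [x])))"
proof -
  have "measure_pmf.expectation (history M L s\<^sub>1 (Suc n)) F =
    (\<Sum>h\<in>set_pmf (history M L s\<^sub>1 n). pmf (history M L s\<^sub>1 n) h *\<^sub>R
      measure_pmf.expectation (map_pmf (\<lambda>x. h @ [x]) (next_step M L s\<^sub>1 h)) F)"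
    unfolding history.simps(2)
    by (rule pmf_expectation_bind) (auto simp: finite_set_history)
  then show ?thesis
    by (simp add: integral_measure_pmf[OF finite_set_history])
qed

section \<open>Instances that restart uniformly\<close>

text \<open>Jumps avoid \<open>s\<^sub>0\<close>, so that as initial state it is entered only at the
  start and through the goal, and its visits are controlled by the goal count. Leaving
  \<open>p\<close> free covers both the hard instances and those they are compared with.\<close>

definition restart_ssp :: "('s::finite \<Rightarrow> 'a::finite \<Rightarrow> real) \<Rightarrow> 's \<Rightarrow> ('s, 'a) ssp" where
  "restart_ssp p s\<^sub>0 =
     \<lparr>trans = (\<lambda>s a. bind_pmf (bernoulli_pmf (p s a))
        (\<lambda>b. if b then return_pmf None else map_pmf Some (pmf_of_set (UNIV - {s\<^sub>0})))),
      cost = (\<lambda>_ _. 1), init = s\<^sub>0\<rparr>"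

lemma cost_restart_ssp [simp]: "cost (restart_ssp p s\<^sub>0) s a = 1"
  and init_restart_ssp [simp]: "init (restart_ssp p s\<^sub>0) = s\<^sub>0"
  by (simp_all add: restart_ssp_def)

lemma step_cost_restart_ssp [simp]: "step_cost (restart_ssp p s\<^sub>0) \<omega> t = 1"
  by (simp add: step_cost_def)

section \<open>Goal counts and sums along a history\<close>

definition goals :: "('s, 'a) step list \<Rightarrow> nat" where
  "goals h = length (filter (\<lambda>x. snd (snd x) = None) h)"

lemma goals_Nil [simp]: "goals [] = 0"
  and goals_snoc [simp]: "goals (h @ [x]) = goals h + of_bool (snd (snd x) = None)"
  by (simp_all add: goals_def)

lemma goals_first_steps: "goals (first_steps \<omega> t) = episode_of \<omega> t"
proof (induction t)
  case (Suc t)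
  have "{u. u < Suc t \<and> step_outcome \<omega> u = None} =
      {u. u < t \<and> step_outcome \<omega> u = None} \<union> (if step_outcome \<omega> t = None then {t} else {})"
    by (auto simp: less_Suc_eq)
  then have "episode_of \<omega> (Suc t) = episode_of \<omega> t + of_bool (step_outcome \<omega> t = None)"
    by (auto simp: episode_of_def)
  with Suc show ?case
    by (simp add: step_outcome_def)
qed (simp add: episode_of_def)

abbreviation at_goal :: "('s, 'a) step \<Rightarrow> real" where
  "at_goal x \<equiv> of_bool (snd (snd x) = None)"

abbreviation unfinished :: "('s, 'a) step list \<Rightarrow> real" where
  "unfinished h \<equiv> of_bool (goals h = 0)"

text \<open>The weight sees the history before the step, so that a factor such as
  \<open>of_bool (goals h < K)\<close> stops the sum right after the step that reaches the
  \<open>K\<close>-th goal.\<close>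

definition path_sum :: "(('s, 'a) step list \<Rightarrow> ('s, 'a) step \<Rightarrow> real) \<Rightarrow> ('s, 'a) step list \<Rightarrow> real" where
  "path_sum w h = (\<Sum>t<length h. w (take t h) (h ! t))"

lemma path_sum_Nil [simp]: "path_sum w [] = 0"
  by (simp add: path_sum_def)

lemma path_sum_snoc [simp]: "path_sum w (h @ [x]) = path_sum w h + w h x"
  by (simp add: path_sum_def nth_append)

lemma path_sum_mono:
  assumes "\<And>h x. w h x \<le> w' h x"
  shows "path_sum w h \<le> path_sum w' h"
  unfolding path_sum_def by (intro sum_mono assms)

lemma path_sum_nonneg:
  assumes "\<And>h x. 0 \<le> w h x"
  shows "0 \<le> path_sum w h"
  unfolding path_sum_def by (intro sum_nonneg assms)

lemma sum_pmf_UNIV: "(\<Sum>a\<in>UNIV. pmf P (a :: 'a :: finite)) = 1"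
  by (rule sum_pmf_eq_1) auto

lemma expectation_next_step:
  fixes M :: "('s::finite, 'a::finite) ssp" and G :: "('s, 'a) step \<Rightarrow> real"
  shows "measure_pmf.expectation (next_step M L s\<^sub>1 h) G =
    (\<Sum>a\<in>UNIV. pmf (L h (state_after s\<^sub>1 h)) a *
       measure_pmf.expectation (trans M (state_after s\<^sub>1 h) a) (\<lambda>y. G (state_after s\<^sub>1 h, a, y)))"
  unfolding next_step_def Let_def
  by (subst pmf_expectation_bind[of UNIV]) auto

lemma expectation_next_step_le:
  fixes M :: "('s::finite, 'a::finite) ssp" and G :: "('s, 'a) step \<Rightarrow> real"
  assumes "\<And>a. measure_pmf.expectation (trans M (state_after s\<^sub>1 h) a) (\<lambda>y. G (state_after s\<^sub>1 h, a, y)) \<le> c"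
  shows "measure_pmf.expectation (next_step M L s\<^sub>1 h) G \<le> c"
proof -
  have "measure_pmf.expectation (next_step M L s\<^sub>1 h) G \<le> (\<Sum>a\<in>UNIV. pmf (L h (state_after s\<^sub>1 h)) a * c)"
    unfolding expectation_next_step by (intro sum_mono mult_left_mono assms) auto
  also have "\<dots> = c"
    unfolding sum_distrib_right[symmetric] sum_pmf_UNIV by simp
  finally show ?thesis .
qed

lemma expectation_next_step_ge:
  fixes M :: "('s::finite, 'a::finite) ssp" and G :: "('s, 'a) step \<Rightarrow> real"
  assumes "\<And>a. c \<le> measure_pmf.expectation (trans M (state_after s\<^sub>1 h) a) (\<lambda>y. G (state_after s\<^sub>1 h, a, y))"
  shows "c \<le> measure_pmf.expectation (next_step M L s\<^sub>1 h) G"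
  using expectation_next_step_le[of M s\<^sub>1 h "\<lambda>x. - G x" "- c" L] assms by simp

text \<open>Linearity and the tower rule: each weight may be replaced by its conditional expectation
  given the preceding history.\<close>

lemma expectation_total:
  fixes M :: "('s::finite, 'a::finite) ssp"
  shows "measure_pmf.expectation (history M L s\<^sub>1 n) (path_sum w) =
    (\<Sum>t<n. measure_pmf.expectation (history M L s\<^sub>1 t)
       (\<lambda>h. measure_pmf.expectation (next_step M L s\<^sub>1 h) (w h)))"
  by (induction n) (simp_all add: expectation_history_Suc integrable_next_step integrable_history)

locale restart =
  fixes p :: "'s::finite \<Rightarrow> 'a::finite \<Rightarrow> real" and s\<^sub>0 :: 's
  assumes p_pos: "0 < p s a" and p_less_1: "p s a < 1" and two_states: "CARD('s) \<ge> 2"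
begin

abbreviation "M \<equiv> restart_ssp p s\<^sub>0"

definition "others = (real CARD('s) - 1)"

lemma others_pos: "0 < others"
  using two_states by (simp add: others_def)

lemma expectation_trans:
  "measure_pmf.expectation (trans M s a) g =
     p s a * g None + (1 - p s a) * (\<Sum>s'\<in>UNIV - {s\<^sub>0}. g (Some s') :: real) / others"
proof -
  have ne: "UNIV - {s\<^sub>0} \<noteq> {}"
  proof
    assume "UNIV - {s\<^sub>0} = {}"
    then have "(UNIV :: 's set) \<subseteq> {s\<^sub>0}" by auto
    from card_mono[OF _ this] two_states show False by simp
  qed
  have card: "real (card (UNIV - {s\<^sub>0})) = others"
    using two_states by (simp add: others_def card_Diff_singleton)
  have "measure_pmf.expectation (trans M s a) g =
      (\<Sum>b\<in>UNIV. pmf (bernoulli_pmf (p s a)) b *\<^sub>R measure_pmf.expectation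
        (if b then return_pmf None else map_pmf Some (pmf_of_set (UNIV - {s\<^sub>0}))) g)"
    unfolding restart_ssp_def ssp.simps by (rule pmf_expectation_bind) auto
  also have "\<dots> = p s a * g None + (1 - p s a) * (\<Sum>s'\<in>UNIV - {s\<^sub>0}. g (Some s')) / others"
    using p_pos[of s a] p_less_1[of s a]
    by (simp add: UNIV_bool integral_pmf_of_set[OF ne] card del: card_Diff_singleton_if card_Diff_insert)
  finally show ?thesis .
qed

lemma expectation_trans_goal:
  "measure_pmf.expectation (trans M s a) (\<lambda>y. of_bool (y = None) :: real) = p s a"
  by (simp add: expectation_trans)

lemma integrable_trans: "integrable (measure_pmf (trans M s a)) (g :: _ \<Rightarrow> real)"
  by (rule integrable_measure_pmf_finite) simp

lemma expectation_goal_ge: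
  assumes "\<And>s a. l \<le> p s a"
  shows "l \<le> measure_pmf.expectation (next_step M L s\<^sub>1 h) at_goal"
  by (rule expectation_next_step_ge) (simp add: expectation_trans_goal assms del: of_bool_eq_iff)

lemma expectation_goal_le:
  assumes "\<And>s a. p s a \<le> u"
  shows "measure_pmf.expectation (next_step M L s\<^sub>1 h) at_goal \<le> u"
  by (rule expectation_next_step_le) (simp add: expectation_trans_goal assms del: of_bool_eq_iff)

lemma survival_Suc:
  "measure_pmf.expectation (history M L s\<^sub>1 (Suc n)) unfinished =
     measure_pmf.expectation (history M L s\<^sub>1 n) (\<lambda>h. unfinished h *
       (1 - measure_pmf.expectation (next_step M L s\<^sub>1 h) at_goal))"
proof -
  have "measure_pmf.expectation (next_step M L s\<^sub>1 h) (\<lambda>x. unfinished (h @ [x])) =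
      measure_pmf.expectation (next_step M L s\<^sub>1 h)
        (\<lambda>x. unfinished h * (1 - at_goal x))" for h
    by (intro arg_cong[where f="measure_pmf.expectation _"] ext) (auto simp: of_bool_def)
  then show ?thesis
    by (simp only: expectation_history_Suc) (simp add: integrable_next_step)
qed

lemma survival_le:
  assumes "\<And>h. l \<le> measure_pmf.expectation (next_step M L s\<^sub>1 h) at_goal"
    and "l \<le> 1"
  shows "measure_pmf.expectation (history M L s\<^sub>1 n) unfinished \<le> (1 - l) ^ n"
proof (induction n)
  case (Suc n)
  have "measure_pmf.expectation (history M L s\<^sub>1 (Suc n)) unfinished \<le>
      measure_pmf.expectation (history M L s\<^sub>1 n) (\<lambda>h. unfinished h * (1 - l))"
    unfolding survival_Suc using assms(1)
    by (intro expectation_history_mono mult_left_mono) auto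
  also have "\<dots> \<le> (1 - l) ^ n * (1 - l)"
    using Suc.IH \<open>l \<le> 1\<close> by (simp add: mult_right_mono)
  finally show ?case
    by (simp add: mult.commute)
qed simp

lemma survival_ge:
  assumes "\<And>h. measure_pmf.expectation (next_step M L s\<^sub>1 h) at_goal \<le> u"
    and "u \<le> 1"
  shows "(1 - u) ^ n \<le> measure_pmf.expectation (history M L s\<^sub>1 n) unfinished"
proof (induction n)
  case (Suc n)
  have "(1 - u) ^ n * (1 - u) \<le>
      measure_pmf.expectation (history M L s\<^sub>1 n) (\<lambda>h. unfinished h * (1 - u))"
    using Suc.IH \<open>u \<le> 1\<close> by (simp add: mult_right_mono)
  also have "\<dots> \<le> measure_pmf.expectation (history M L s\<^sub>1 (Suc n)) unfinished"
    unfolding survival_Suc using assms(1)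
    by (intro expectation_history_mono mult_left_mono) auto
  finally show ?case
    by (simp add: mult.commute)
qed simp

lemma expectation_goals_le:
  assumes "\<And>s a. p s a \<le> u"
  shows "measure_pmf.expectation (history M L s\<^sub>1 n) (\<lambda>h. real (goals h)) \<le> n * u"
proof (induction n)
  case (Suc n)
  let ?g = "\<lambda>h. measure_pmf.expectation (next_step M L s\<^sub>1 h) at_goal"
  have "measure_pmf.expectation (history M L s\<^sub>1 (Suc n)) (\<lambda>h. real (goals h)) =
      measure_pmf.expectation (history M L s\<^sub>1 n) (\<lambda>h. real (goals h) + ?g h)"
    by (simp only: expectation_history_Suc goals_snoc of_nat_add of_nat_of_bool)
       (simp add: integrable_next_step)
  also have "\<dots> \<le> measure_pmf.expectation (history M L s\<^sub>1 n) (\<lambda>h. real (goals h) + u)"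
    using expectation_goal_le[OF assms]
    by (intro expectation_history_mono) auto
  also have "\<dots> \<le> n * u + u"
    using Suc by (simp add: integrable_history)
  finally show ?case
    by (simp add: algebra_simps)
qed simp

end

section \<open>Cost to go and regret\<close>

lemma take_first_steps: "t \<le> n \<Longrightarrow> take t (first_steps \<omega> n) = first_steps \<omega> t"
  by (simp add: take_map)

lemma path_sum_first_steps: "path_sum w (first_steps \<omega> n) = (\<Sum>t<n. w (first_steps \<omega> t) (\<omega> t))"
  unfolding path_sum_def by (auto intro!: sum.cong simp: take_first_steps simp del: take_map)

text \<open>The bound is pointwise, so that \<open>X\<close> need not be measurable.\<close>

lemma ereal_expectation_ge:
  assumes Y: "integrable N Y" and le: "\<And>\<omega>. ereal (Y \<omega>) \<le> X \<omega>"
  shows "ereal (integral\<^sup>L N Y) \<le> ereal_expectation N X"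
proof -
  have e2: "ennreal y = e2ennreal (ereal y)" for y
    by (simp add: e2ennreal_def ennreal.abs_eq)
  have fin: "(\<integral>\<^sup>+\<omega>. ennreal (Y \<omega>) \<partial>N) \<noteq> \<infinity>" "(\<integral>\<^sup>+\<omega>. ennreal (- Y \<omega>) \<partial>N) \<noteq> \<infinity>"
    using Y unfolding real_integrable_def by auto
  have "(\<integral>\<^sup>+\<omega>. ennreal (Y \<omega>) \<partial>N) \<le> (\<integral>\<^sup>+\<omega>. e2ennreal (X \<omega>) \<partial>N)"
    unfolding e2 by (intro nn_integral_mono e2ennreal_mono le)
  moreover have "e2ennreal (- X \<omega>) \<le> ennreal (- Y \<omega>)" for \<omega>
    unfolding e2 uminus_ereal.simps[symmetric] using le[of \<omega>]
    by (intro e2ennreal_mono) (simp only: ereal_minus_le_minus)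
  then have "(\<integral>\<^sup>+\<omega>. e2ennreal (- X \<omega>) \<partial>N) \<le> (\<integral>\<^sup>+\<omega>. ennreal (- Y \<omega>) \<partial>N)"
    by (intro nn_integral_mono)
  moreover have "ereal (integral\<^sup>L N Y) =
      enn2ereal (\<integral>\<^sup>+\<omega>. ennreal (Y \<omega>) \<partial>N) - enn2ereal (\<integral>\<^sup>+\<omega>. ennreal (- Y \<omega>) \<partial>N)"
    using fin unfolding real_lebesgue_integral_def[OF Y]
    by (cases "\<integral>\<^sup>+\<omega>. ennreal (Y \<omega>) \<partial>N"; cases "\<integral>\<^sup>+\<omega>. ennreal (- Y \<omega>) \<partial>N")
       (auto simp: enn2ereal_ennreal)
  ultimately show ?thesis
    unfolding ereal_expectation_def
    by (auto intro!: ereal_minus_mono simp: less_eq_ennreal.rep_eq)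
qed

lemma episode_steps_0: "t \<in> episode_steps \<omega> 0 \<longleftrightarrow> goals (first_steps \<omega> t) = 0"
  by (simp add: episode_steps_def goals_first_steps)

context restart
begin

text \<open>Finiteness gives a positive minimum \<open>l\<close> of all goal probabilities, so
  missing the goal for \<open>n\<close> steps has probability at most \<open>(1 - l) ^ n\<close>,
  which tends to 0.\<close>

lemma proper_restart: "proper M \<pi>"
  unfolding proper_def
proof
  fix s
  let ?R = "run M (policy_learner \<pi>) s"
  let ?A = "\<lambda>n. {\<omega>\<in>space ?R. goals (first_steps \<omega> n) = 0}"
  interpret R: prob_space ?R
    by (rule prob_space_run)
  define l where "l = Min (range (\<lambda>(s, a). p s a))"
  have l_le: "l \<le> p s a" for s a
    unfolding l_def by (rule Min_le) auto
  have "l \<in> range (\<lambda>(s, a). p s a)"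
    unfolding l_def by (rule Min_in) auto
  then have l: "0 < l" "l < 1"
    using p_pos p_less_1 by auto
  have A: "?A n \<in> sets ?R" for n
  proof -
    have "?A n = (\<lambda>\<omega>. first_steps \<omega> n) -` {h. goals h = 0} \<inter> space ?R"
      by auto
    then show ?thesis
      using measurable_sets[OF measurable_prefix, of "{h. goals h = 0}" n M "policy_learner \<pi>" s] by simp
  qed
  have "R.prob (\<Inter>n. ?A n) \<le> (1 - l) ^ n" for n
  proof -
    have "R.prob (\<Inter>n. ?A n) \<le> R.prob (?A n)"
      by (intro R.finite_measure_mono A) auto
    also have "\<dots> = (\<integral>\<omega>. unfinished (first_steps \<omega> n) \<partial>?R)"
    proof -
      have "(\<integral>\<omega>. unfinished (first_steps \<omega> n) \<partial>?R) = (\<integral>\<omega>. indicator (?A n) \<omega> \<partial>?R)"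
        by (intro Bochner_Integration.integral_cong) (auto simp: indicator_def)
      then show ?thesis
        using A by (simp del: integral_indicator add: integral_indicator)
    qed
    also have "\<dots> = measure_pmf.expectation (history M (policy_learner \<pi>) s n) unfinished"
      by (rule integral_run_prefix)
    also have "\<dots> \<le> (1 - l) ^ n"
      using l by (intro survival_le expectation_goal_ge l_le) auto
    finally show ?thesis .
  qed
  moreover have "(\<lambda>n. (1 - l) ^ n) \<longlonglongrightarrow> 0"
    using l by (intro LIMSEQ_power_zero) auto
  ultimately have "R.prob (\<Inter>n. ?A n) \<le> 0"
    by (intro LIMSEQ_le_const) auto
  then have "emeasure ?R (\<Inter>n. ?A n) = 0"
    using measure_nonneg[of ?R "\<Inter>n. ?A n"] by (simp add: R.emeasure_eq_measure del: measure_nonneg)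
  moreover have "(\<Inter>n. ?A n) \<in> sets ?R"
    using A by blast
  moreover have "{\<omega> \<in> space ?R. \<not> (\<exists>t. step_outcome \<omega> t = None)} \<subseteq> (\<Inter>n. ?A n)"
    by (auto simp: goals_first_steps episode_of_def)
  ultimately show "AE \<omega> in ?R. \<exists>t. step_outcome \<omega> t = None"
    by (intro AE_I)
qed

text \<open>The tail-sum formula: with unit costs the cost to go is the expected length of the first
  episode.\<close>

lemma cost_to_go_eq:
  "cost_to_go M \<pi> s = (\<Sum>t. ennreal (measure_pmf.expectation
     (history M (policy_learner \<pi>) s t) unfinished))"
proof -
  let ?R = "run M (policy_learner \<pi>) s"
  have "cost_to_go M \<pi> s = (\<integral>\<^sup>+\<omega>. (\<Sum>t. of_bool (goals (first_steps \<omega> t) = 0)) \<partial>?R)"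
    unfolding cost_to_go_def episode_steps_0
    by (intro nn_integral_cong suminf_cong) simp
  also have "\<dots> = (\<Sum>t. \<integral>\<^sup>+\<omega>. of_bool (goals (first_steps \<omega> t) = 0) \<partial>?R)"
    by (intro nn_integral_suminf measurable_compose[OF measurable_prefix]) simp
  also have "\<dots> = (\<Sum>t. ennreal (measure_pmf.expectation
     (history M (policy_learner \<pi>) s t) unfinished))"
  proof (rule suminf_cong)
    fix t
    have "(\<integral>\<^sup>+\<omega>. of_bool (goals (first_steps \<omega> t) = 0) \<partial>?R) =
        (\<integral>\<^sup>+h. ennreal (of_bool (goals h = 0)) \<partial>history M (policy_learner \<pi>) s t)"
      by (subst nn_integral_run_prefix) (intro nn_integral_cong, simp)
    then show "(\<integral>\<^sup>+\<omega>. of_bool (goals (first_steps \<omega> t) = 0) \<partial>?R) = ennreal (measure_pmf.expectation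
        (history M (policy_learner \<pi>) s t) unfinished)"
      by (simp add: nn_integral_eq_integral[OF integrable_history])
  qed
  finally show ?thesis .
qed

lemma suminf_geometric_ennreal:
  assumes "B > 1"
  shows "(\<Sum>t. ennreal ((1 - 1 / B) ^ t)) = ennreal B"
proof -
  have "norm (1 - 1 / B) < 1"
    using assms by (auto simp: field_simps)
  then show ?thesis
    using assms suminf_geometric[of "1 - 1 / B"]
    by (subst suminf_ennreal2) (auto simp: summable_geometric)
qed

text \<open>No action reaches the goal with probability above \<open>1 / B\<close>, so survival
  dominates that of a geometric law with mean \<open>B\<close>.\<close>

lemma cost_to_go_ge:
  assumes "\<And>s a. p s a \<le> 1 / B" and B: "B > 1"
  shows "ennreal B \<le> cost_to_go M \<pi> s"
proof -
  have "1 / B \<le> 1"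
    using B by simp
  then show ?thesis
    unfolding cost_to_go_eq suminf_geometric_ennreal[OF B, symmetric]
    by (intro suminf_le ennreal_leI survival_ge expectation_goal_le assms) auto
qed

lemma cost_to_go_le:
  assumes "\<And>s. p s (\<pi> s) = 1 / B" and B: "B > 1"
  shows "cost_to_go M \<pi> s \<le> ennreal B"
proof -
  have "1 / B \<le> 1"
    using B by simp
  moreover have "measure_pmf.expectation (next_step M (policy_learner \<pi>) s h) at_goal = 1 / B" for h
    by (simp add: next_step_def policy_learner_def Let_def bind_return_pmf expectation_trans_goal assms
       del: of_bool_eq_iff)
  ultimately show ?thesis
    unfolding cost_to_go_eq suminf_geometric_ennreal[OF B, symmetric]
    by (intro suminf_le ennreal_leI survival_le) auto
qed

lemma optimal_proper_restart:
  assumes "\<And>s a. p s a \<le> 1 / B" "\<And>s. p s (\<pi> s) = 1 / B" "B > 1"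
  shows "optimal_proper_policy M \<pi>"
  unfolding optimal_proper_policy_def
proof (intro conjI allI impI proper_restart)
  show "cost_to_go M \<pi> s \<le> cost_to_go M \<pi>' s" for \<pi>' s
    using cost_to_go_le[OF assms(2,3), of s] cost_to_go_ge[OF assms(1,3), of \<pi>' s] by (rule order_trans)
qed

text \<open>An unfinished episode makes the regret infinite; otherwise the steps before
  \<open>n\<close> that belong to the first \<open>K\<close> episodes are among all steps of these
  episodes. Truncation at \<open>n\<close> makes the bound a function of a finite prefix.\<close>

lemma regret_ge:
  assumes "cost_to_go M \<pi> s\<^sub>0 = ennreal B" "B > 0"
  shows "ereal (path_sum (\<lambda>h x. of_bool (goals h < K)) (first_steps \<omega> n) - K * B) \<le> regret M \<pi> K \<omega>"
proof (cases "\<exists>k<K. infinite (episode_steps \<omega> k)")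
  case False
  have "path_sum (\<lambda>h x. of_bool (goals h < K)) (first_steps \<omega> n) = (\<Sum>t<n. of_bool (episode_of \<omega> t < K))"
    by (simp add: path_sum_first_steps goals_first_steps)
  also have "\<dots> = real (card {t. t < n \<and> episode_of \<omega> t < K})"
    by (simp add: sum_of_bool_eq Int_def)
  also have "\<dots> \<le> real (card (\<Union>k<K. episode_steps \<omega> k))"
    using False by (intro of_nat_mono card_mono) (auto simp: episode_steps_def)
  also have "card (\<Union>k<K. episode_steps \<omega> k) = (\<Sum>k<K. card (episode_steps \<omega> k))"
    using False by (intro card_UN_disjoint) (auto simp: episode_steps_def)
  finally have "path_sum (\<lambda>h x. of_bool (goals h < K)) (first_steps \<omega> n) - K * B \<le>
      real (\<Sum>k<K. card (episode_steps \<omega> k)) - K * B"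
    by linarith
  also have "ereal \<dots> = regret M \<pi> K \<omega>"
    unfolding regret_def if_not_P[OF False] init_restart_ssp assms(1) using assms(2) by (simp add: enn2ereal_ennreal)
  finally show ?thesis
    by simp
qed (simp add: regret_def)

lemma expected_regret_ge:
  assumes "cost_to_go M \<pi> s\<^sub>0 = ennreal B" "B > 0"
  shows "ereal (measure_pmf.expectation (history M L s\<^sub>0 n) (path_sum (\<lambda>h x. of_bool (goals h < K))) - K * B)
    \<le> expected_regret M \<pi> L K"
proof -
  let ?F = "\<lambda>h. path_sum (\<lambda>h x. of_bool (goals h < K)) h - K * B"
  have "integrable (history M L s\<^sub>0 n) ?F"
    by (rule integrable_history)
  then have int: "integrable (run M L s\<^sub>0) (\<lambda>\<omega>. ?F (first_steps \<omega> n))"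
    by (intro integrable_distr[OF measurable_prefix]) (simp only: distr_run_prefix)
  have "measure_pmf.expectation (history M L s\<^sub>0 n) (path_sum (\<lambda>h x. of_bool (goals h < K))) - K * B =
      measure_pmf.expectation (history M L s\<^sub>0 n) ?F"
    by (simp add: integrable_history)
  also have "\<dots> = (\<integral>\<omega>. ?F (first_steps \<omega> n) \<partial>run M L s\<^sub>0)"
    by (rule integral_run_prefix[symmetric])
  finally show ?thesis
    unfolding expected_regret_def init_restart_ssp
    using ereal_expectation_ge[OF int regret_ge[OF assms]] by simp
qed

end

section \<open>Visits, durations and regret\<close>

text \<open>Given the past, the current state is already determined, whereas the next arrival in
  \<open>s\<close> is random with a bounded probability. Hence arrivals, not visits, admit moment
  bounds by conditioning one step at a time.\<close>

abbreviation entries :: "'s \<Rightarrow> ('s, 'a) step list \<Rightarrow> real" where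
  "entries s \<equiv> path_sum (\<lambda>_ x. of_bool (snd (snd x) = Some s))"

abbreviation visits :: "'s \<Rightarrow> ('s, 'a) step list \<Rightarrow> real" where
  "visits s \<equiv> path_sum (\<lambda>_ x. of_bool (fst x = s))"

abbreviation plays :: "'s \<Rightarrow> 'a \<Rightarrow> ('s, 'a) step list \<Rightarrow> real" where
  "plays s a \<equiv> path_sum (\<lambda>_ x. of_bool (fst x = s \<and> fst (snd x) = a))"

lemma state_after_snoc:
  "state_after s\<^sub>1 (h @ [x]) = (case snd (snd x) of None \<Rightarrow> s\<^sub>1 | Some s' \<Rightarrow> s')"
  by (simp add: state_after_def)

lemma fst_next_step: "x \<in> set_pmf (next_step M L s\<^sub>1 h) \<Longrightarrow> fst x = state_after s\<^sub>1 h"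
  by (auto simp: next_step_def Let_def)

context restart
begin

lemma outcome_neq_init:
  assumes "x \<in> set_pmf (next_step M L s\<^sub>1 h)"
  shows "snd (snd x) \<noteq> Some s\<^sub>0"
proof -
  have "pmf (trans M s a) (Some s\<^sub>0) = measure_pmf.expectation (trans M s a) (\<lambda>y. of_bool (y = Some s\<^sub>0))" for s a
  proof -
    have "(\<lambda>y. of_bool (y = Some s\<^sub>0)) = (indicator {Some s\<^sub>0} :: _ \<Rightarrow> real)"
      by (auto simp: indicator_def)
    then show ?thesis
      by (simp add: measure_pmf_single)
  qed
  then have "pmf (trans M s a) (Some s\<^sub>0) = 0" for s a
    by (simp add: expectation_trans)
  then show ?thesis
    using assms by (auto simp: next_step_def Let_def set_pmf_iff)
qed

text \<open>Both sides count the arrivals at \<open>s\<^sub>0\<close>: the start and one for each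
  goal. An occupied state counts as visited only once a step has been played in it, whence the
  second term on the left.\<close>

lemma visits_init:
  "h \<in> set_pmf (history M L s\<^sub>0 n) \<Longrightarrow> visits s\<^sub>0 h + of_bool (state_after s\<^sub>0 h = s\<^sub>0) = 1 + real (goals h)"
proof (induction n arbitrary: h)
  case (Suc n)
  then obtain h' x where h: "h = h' @ [x]" "h' \<in> set_pmf (history M L s\<^sub>0 n)"
    and x: "x \<in> set_pmf (next_step M L s\<^sub>0 h')"
    by (auto simp: history.simps)
  show ?case
    using Suc.IH[OF h(2)] outcome_neq_init[OF x] fst_next_step[OF x]
    by (auto simp: h(1) state_after_snoc split: option.splits)
qed (simp add: state_after_def)

lemma visits_eq_entries:
  assumes "s \<noteq> s\<^sub>0"
  shows "h \<in> set_pmf (history M L s\<^sub>0 n) \<Longrightarrow> visits s h + of_bool (state_after s\<^sub>0 h = s) = entries s h"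
proof (induction n arbitrary: h)
  case (Suc n)
  then obtain h' x where h: "h = h' @ [x]" "h' \<in> set_pmf (history M L s\<^sub>0 n)"
    and x: "x \<in> set_pmf (next_step M L s\<^sub>0 h')"
    by (auto simp: history.simps)
  show ?case
    using Suc.IH[OF h(2)] fst_next_step[OF x] assms
    by (auto simp: h(1) state_after_snoc split: option.splits)
qed (use assms in \<open>simp add: state_after_def\<close>)

lemma expectation_entry_le:
  assumes "\<And>s a. 1 - p s a \<le> w" and "s \<noteq> s\<^sub>0"
  shows "measure_pmf.expectation (next_step M L s\<^sub>1 h) (\<lambda>x. of_bool (snd (snd x) = Some s)) \<le> w / others"
proof (rule expectation_next_step_le)
  fix a
  have "(\<Sum>s'\<in>UNIV - {s\<^sub>0}. of_bool (s' = s)) = (1 :: real)"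
    using assms(2) by (simp add: of_bool_def if_distrib sum.delta cong: if_cong)
  then have "measure_pmf.expectation (trans M s'' a) (\<lambda>y. of_bool (y = Some s)) = (1 - p s'' a) / others" for s''
    by (simp add: expectation_trans)
  then show "measure_pmf.expectation (trans M (state_after s\<^sub>1 h) a)
      (\<lambda>y. of_bool (snd (snd (state_after s\<^sub>1 h, a, y)) = Some s)) \<le> w / others"
    using assms(1) others_pos by (simp add: divide_right_mono)
qed

text \<open>The count grows by an indicator of conditional mean at most \<open>r\<close>, so its
  moments are bounded like those of a binomial variable. For an indicator \<open>e\<close>,
  \<open>(v + e)^2 = v^2 + (2 * v + 1) * e\<close>, which gives the recursion of the second
  moment.\<close>

lemma entries_moments:
  assumes w: "\<And>s a. 1 - p s a \<le> w" and s: "s \<noteq> s\<^sub>0"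
  shows "measure_pmf.expectation (history M L s\<^sub>1 n) (entries s) \<le> n * (w / others)"
    and "measure_pmf.expectation (history M L s\<^sub>1 n) (\<lambda>h. (entries s h)\<^sup>2) \<le>
      n * (w / others) + (n * (w / others))\<^sup>2"
proof -
  define r where "r = w / others"
  let ?e = "\<lambda>x. of_bool (snd (snd x) = Some s) :: real"
  let ?g = "\<lambda>h. measure_pmf.expectation (next_step M L s\<^sub>1 h) ?e"
  have g: "?g h \<le> r" for h
    unfolding r_def by (rule expectation_entry_le[OF w s])
  have r0: "0 \<le> r"
    using g[of undefined] by (rule order_trans[rotated]) simp
  have first: "measure_pmf.expectation (history M L s\<^sub>1 n) (entries s) \<le> n * r" for n
  proof -
    have "measure_pmf.expectation (history M L s\<^sub>1 n) (entries s) \<le> (\<Sum>t<n. r)"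
      unfolding expectation_total
    proof (rule sum_mono)
      fix t
      have "measure_pmf.expectation (history M L s\<^sub>1 t) ?g \<le> measure_pmf.expectation (history M L s\<^sub>1 t) (\<lambda>_. r)"
        by (intro expectation_history_mono g)
      then show "measure_pmf.expectation (history M L s\<^sub>1 t) ?g \<le> r"
        by simp
    qed
    then show ?thesis
      by simp
  qed
  show "measure_pmf.expectation (history M L s\<^sub>1 n) (entries s) \<le> n * (w / others)"
    using first unfolding r_def .
  have "measure_pmf.expectation (history M L s\<^sub>1 n) (\<lambda>h. (entries s h)\<^sup>2) \<le> n * r + (n * r)\<^sup>2"
  proof (induction n)
    case (Suc n)
    let ?E = "measure_pmf.expectation (history M L s\<^sub>1 n)"
    have e_nonneg: "0 \<le> 2 * entries s h + 1" for h :: "('s, 'a) step list"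
      using path_sum_nonneg[of "\<lambda>_. ?e" h] by simp
    have sq: "(v + ?e x)\<^sup>2 = v\<^sup>2 + (2 * v + 1) * ?e x" for v x
      by (simp add: power2_eq_square algebra_simps)
    have "measure_pmf.expectation (history M L s\<^sub>1 (Suc n)) (\<lambda>h. (entries s h)\<^sup>2) =
        ?E (\<lambda>h. (entries s h)\<^sup>2 + (2 * entries s h + 1) * ?g h)"
      unfolding expectation_history_Suc path_sum_snoc sq by (simp add: integrable_next_step)
    also have "\<dots> \<le> ?E (\<lambda>h. (entries s h)\<^sup>2 + (2 * entries s h + 1) * r)"
      by (intro expectation_history_mono add_left_mono mult_left_mono g e_nonneg)
    also have "\<dots> = ?E (\<lambda>h. (entries s h)\<^sup>2) + (2 * ?E (entries s) + 1) * r"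
      by (simp add: integrable_history)
    also have "\<dots> \<le> (n * r + (n * r)\<^sup>2) + (2 * (n * r) + 1) * r"
      using Suc first[of n] r0 by (intro add_mono mult_right_mono) auto
    also have "\<dots> \<le> Suc n * r + (Suc n * r)\<^sup>2"
      by (simp add: power2_eq_square algebra_simps)
    finally show ?case .
  qed simp
  then show "measure_pmf.expectation (history M L s\<^sub>1 n) (\<lambda>h. (entries s h)\<^sup>2) \<le>
      n * (w / others) + (n * (w / others))\<^sup>2"
    unfolding r_def .
qed

text \<open>If \<open>1 - B * p s a\<close>, the loss of playing \<open>a\<close> in \<open>s\<close> against the constant value function \<open>B\<close>, is
  \<open>\<delta> * bad s a\<close>, then time minus \<open>B\<close> times the number of goals, minus \<open>\<delta>\<close> times
  the number of bad plays, is a martingale; it is stopped here at the \<open>K\<close>-th goal.\<close>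

lemma expectation_duration:
  assumes gap: "\<And>s a. 1 - B * p s a = \<delta> * bad s a"
  shows "measure_pmf.expectation (history M L s\<^sub>1 n) (path_sum (\<lambda>h x. of_bool (goals h < K))) =
    B * measure_pmf.expectation (history M L s\<^sub>1 n) (\<lambda>h. real (min K (goals h))) +
    \<delta> * measure_pmf.expectation (history M L s\<^sub>1 n)
      (path_sum (\<lambda>h x. of_bool (goals h < K) * bad (fst x) (fst (snd x))))"
    (is "?E (path_sum ?D) = B * ?E ?G + \<delta> * ?E (path_sum ?b)")
proof -
  have "?E (path_sum (\<lambda>h x. of_bool (goals h < K) * (1 - B * at_goal x - \<delta> * bad (fst x) (fst (snd x))))) = 0"
    unfolding expectation_total
  proof (intro sum.neutral ballI)
    fix t
    have "measure_pmf.expectation (trans M s a) (\<lambda>y. 1 - B * of_bool (y = None) - \<delta> * bad s a) = 0" for s a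
      using gap[of s a]
      by (simp add: integrable_trans expectation_trans_goal del: of_bool_eq_iff)
    then have "measure_pmf.expectation (next_step M L s\<^sub>1 h)
        (\<lambda>x. 1 - B * at_goal x - \<delta> * bad (fst x) (fst (snd x))) = 0" for h
      by (simp add: expectation_next_step)
    then show "measure_pmf.expectation (history M L s\<^sub>1 t) (\<lambda>h. measure_pmf.expectation (next_step M L s\<^sub>1 h)
        (\<lambda>x. of_bool (goals h < K) * (1 - B * at_goal x - \<delta> * bad (fst x) (fst (snd x))))) = 0"
      by simp
  qed
  moreover have "path_sum (\<lambda>h x. of_bool (goals h < K) * (1 - B * at_goal x - \<delta> * bad (fst x) (fst (snd x)))) h =
      path_sum ?D h - B * ?G h - \<delta> * path_sum ?b h" for h :: "('s, 'a) step list"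
    by (induction h rule: rev_induct) (auto simp: algebra_simps)
  ultimately show ?thesis
    by (simp add: integrable_history)
qed

text \<open>Each step before the \<open>K\<close>-th goal reaches the goal with probability at least
  \<open>l\<close>, so the expected number of such steps is at most \<open>K / l\<close> and the
  probabilities are summable.\<close>

lemma unfinished_tendsto_0:
  "(\<lambda>n. measure_pmf.expectation (history M L s\<^sub>1 n) (\<lambda>h. of_bool (goals h < K)) :: real) \<longlonglongrightarrow> 0"
proof -
  let ?d = "\<lambda>n. measure_pmf.expectation (history M L s\<^sub>1 n) (\<lambda>h. of_bool (goals h < K)) :: real"
  define l where "l = Min (range (\<lambda>(s, a). p s a))"
  have l_le: "l \<le> p s a" for s a
    unfolding l_def by (rule Min_le) auto
  have "l \<in> range (\<lambda>(s, a). p s a)"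
    unfolding l_def by (rule Min_in) auto
  then have l: "0 < l"
    using p_pos by auto
  have "l * (\<Sum>t<n. ?d t) \<le> K" for n
  proof -
    have "l * (\<Sum>t<n. ?d t) = (\<Sum>t<n. measure_pmf.expectation (history M L s\<^sub>1 t) (\<lambda>h. of_bool (goals h < K) * l))"
      by (simp add: sum_distrib_left mult.commute)
    also have "\<dots> \<le> (\<Sum>t<n. measure_pmf.expectation (history M L s\<^sub>1 t)
        (\<lambda>h. measure_pmf.expectation (next_step M L s\<^sub>1 h) (\<lambda>x. of_bool (goals h < K) * at_goal x)))"
      using expectation_goal_ge[OF l_le] by (intro sum_mono expectation_history_mono) (simp add: mult_left_mono)
    also have "\<dots> = measure_pmf.expectation (history M L s\<^sub>1 n) (path_sum (\<lambda>h x. of_bool (goals h < K) * at_goal x))"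
      by (rule expectation_total[symmetric])
    also have "\<dots> \<le> measure_pmf.expectation (history M L s\<^sub>1 n) (\<lambda>_. real K)"
    proof (rule expectation_history_mono)
      fix h :: "('s, 'a) step list"
      have "path_sum (\<lambda>h x. of_bool (goals h < K) * at_goal x) h = real (min K (goals h))"
        by (induction h rule: rev_induct) auto
      then show "path_sum (\<lambda>h x. of_bool (goals h < K) * at_goal x) h \<le> real K"
        by simp
    qed
    finally show ?thesis
      by simp
  qed
  then have "(\<Sum>t<n. ?d t) \<le> K / l" for n
    using l by (simp add: field_simps)
  then have "summable ?d"
    by (intro summableI_nonneg_bounded[where x="K / l"]) auto
  then show ?thesis
    by (rule summable_LIMSEQ_zero)
qed

text \<open>The martingale identity is used at a horizon \<open>n \<ge> T\<close>. Bad plays only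
  accumulate from \<open>T\<close> to \<open>n\<close>, and missing goals cost at most
  \<open>B * K\<close> times the probability of fewer than \<open>K\<close> goals, which vanishes as
  \<open>n\<close> grows.\<close>

lemma expected_regret_ge_bad:
  assumes gap: "\<And>s a. 1 - B * p s a = \<delta> * bad s a" and nonneg: "\<And>s a. 0 \<le> bad s a" "0 \<le> \<delta>"
    and B: "cost_to_go M \<pi> s\<^sub>0 = ennreal B" "B > 0"
  shows "ereal (\<delta> * measure_pmf.expectation (history M L s\<^sub>0 T)
      (path_sum (\<lambda>h x. of_bool (goals h < K) * bad (fst x) (fst (snd x))))) \<le> expected_regret M \<pi> L K"
proof -
  let ?E = "\<lambda>n. measure_pmf.expectation (history M L s\<^sub>0 n)"
  let ?b = "path_sum (\<lambda>h x. of_bool (goals h < K) * bad (fst x) (fst (snd x)))"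
  let ?d = "\<lambda>n. ?E n (\<lambda>h. of_bool (goals h < K)) :: real"
  have "ereal (\<delta> * ?E T ?b - B * K * ?d n) \<le> expected_regret M \<pi> L K" if "n \<ge> T" for n
  proof -
    have "?E T ?b \<le> ?E n ?b"
      unfolding expectation_total using that
      by (intro sum_mono2) (auto intro!: Bochner_Integration.integral_nonneg nonneg mult_nonneg_nonneg)
    then have 1: "\<delta> * ?E T ?b \<le> \<delta> * ?E n ?b"
      using nonneg(2) by (rule mult_left_mono)
    have "?E n (\<lambda>h. real K - real K * of_bool (goals h < K)) \<le> ?E n (\<lambda>h. real (min K (goals h)))"
      by (intro expectation_history_mono) auto
    then have "real K - real K * ?d n \<le> ?E n (\<lambda>h. real (min K (goals h)))"
      by (simp add: integrable_history)
    from mult_left_mono[OF this, of B] B(2) have 2: "B * K - B * K * ?d n \<le> B * ?E n (\<lambda>h. real (min K (goals h)))"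
      by (simp add: algebra_simps)
    have "\<delta> * ?E T ?b - B * K * ?d n \<le> ?E n (path_sum (\<lambda>h x. of_bool (goals h < K))) - K * B"
      unfolding expectation_duration[OF gap] using 1 2 by (simp add: algebra_simps)
    then have "ereal (\<delta> * ?E T ?b - B * K * ?d n) \<le> ereal (?E n (path_sum (\<lambda>h x. of_bool (goals h < K))) - K * B)"
      by simp
    also have "\<dots> \<le> expected_regret M \<pi> L K"
      by (rule expected_regret_ge[OF B])
    finally show ?thesis .
  qed
  moreover have "(\<lambda>n. ereal (\<delta> * ?E T ?b - B * K * ?d n)) \<longlonglongrightarrow> ereal (\<delta> * ?E T ?b - B * K * 0)"
    by (intro tendsto_intros unfinished_tendsto_0)
  ultimately show ?thesis
    by (intro LIMSEQ_le_const2[where X="\<lambda>n. ereal (\<delta> * ?E T ?b - B * K * ?d n)"]) auto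
qed

end

section \<open>Change of measure\<close>

text \<open>AM-GM applied to \<open>(z - 1) * N = (sqrt z - 1) * (sqrt z + 1) * N\<close>, where
  \<open>(sqrt z - 1)\<^sup>2 \<le> z - 1 - ln z\<close>. In expectation under \<open>Q\<close>, with \<open>z = dP / dQ\<close>, it bounds the change of the
  mean of \<open>N\<close> from \<open>Q\<close> to \<open>P\<close> by the relative entropy and the second moments of \<open>N\<close>, and \<open>N\<close> need not be bounded.\<close>

lemma change_of_measure_pointwise:
  fixes z N \<mu> :: real
  assumes "z > 0" "\<mu> > 0"
  shows "(z - 1) * N \<le> \<mu> / 2 * (z - 1 - ln z) + (z + 1) * N\<^sup>2 / \<mu>"
proof -
  define r where "r = sqrt z"
  have r: "r > 0" "z = r\<^sup>2"
    using assms by (auto simp: r_def)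
  have "ln z = 2 * ln r"
    using r by (simp add: ln_realpow)
  also have "\<dots> \<le> 2 * (r - 1)"
    using ln_le_minus_one[OF r(1)] by simp
  finally have 1: "(r - 1)\<^sup>2 \<le> z - 1 - ln z"
    unfolding r(2) by (simp add: power2_eq_square algebra_simps)
  have "0 \<le> (\<mu> * (r - 1) - (r + 1) * N)\<^sup>2"
    by simp
  then have "2 * (\<mu> * ((r - 1) * (r + 1) * N)) \<le> \<mu>\<^sup>2 * (r - 1)\<^sup>2 + (r + 1)\<^sup>2 * N\<^sup>2"
    by (simp add: power2_eq_square algebra_simps)
  also have "\<dots> \<le> \<mu>\<^sup>2 * (r - 1)\<^sup>2 + 2 * (z + 1) * N\<^sup>2"
  proof -
    have "(r + 1)\<^sup>2 \<le> 2 * (z + 1)"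
      using zero_le_power2[of "r - 1"] unfolding r(2) by (simp add: power2_eq_square algebra_simps)
    then show ?thesis
      by (intro add_left_mono mult_right_mono) auto
  qed
  also have "\<dots> \<le> \<mu>\<^sup>2 * (z - 1 - ln z) + 2 * (z + 1) * N\<^sup>2"
    using 1 by (intro add_right_mono mult_left_mono) auto
  finally have "2 * (\<mu> * ((z - 1) * N)) \<le> \<mu>\<^sup>2 * (z - 1 - ln z) + 2 * (z + 1) * N\<^sup>2"
    unfolding r(2) by (simp add: power2_eq_square algebra_simps)
  then show ?thesis
    using assms(2) by (simp add: field_simps power2_eq_square)
qed

locale change_of_ssp = P: restart p s\<^sub>0 + Q: restart q s\<^sub>0
  for p q :: "'s::finite \<Rightarrow> 'a::finite \<Rightarrow> real" and s\<^sub>0 :: 's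
begin

text \<open>The learner's action probabilities and the uniform choice of the next state are common
  to both instances and cancel, so only whether the goal was reached matters.\<close>

definition step_ratio :: "('s, 'a) step \<Rightarrow> real" where
  "step_ratio = (\<lambda>(s, a, y). if y = None then p s a / q s a else (1 - p s a) / (1 - q s a))"

definition likelihood_ratio :: "('s, 'a) step list \<Rightarrow> real" where
  "likelihood_ratio h = prod_list (map step_ratio h)"

lemma likelihood_ratio_Nil [simp]: "likelihood_ratio [] = 1"
  and likelihood_ratio_snoc [simp]: "likelihood_ratio (h @ [x]) = likelihood_ratio h * step_ratio x"
  by (simp_all add: likelihood_ratio_def)

lemma step_ratio_pos: "0 < step_ratio x"
  using P.p_pos P.p_less_1 Q.p_pos Q.p_less_1 by (auto simp: step_ratio_def split: prod.split)

lemma likelihood_ratio_pos: "0 < likelihood_ratio h"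
  by (induction h rule: rev_induct) (auto simp: step_ratio_pos)

lemma expectation_next_step_change:
  "measure_pmf.expectation (next_step P.M L s\<^sub>1 h) G =
    measure_pmf.expectation (next_step Q.M L s\<^sub>1 h) (\<lambda>x. step_ratio x * G x)"
  unfolding expectation_next_step
proof (intro sum.cong refl arg_cong2[where f="(*)"])
  fix a
  let ?s = "state_after s\<^sub>1 h"
  show "measure_pmf.expectation (trans P.M ?s a) (\<lambda>y. G (?s, a, y)) =
      measure_pmf.expectation (trans Q.M ?s a) (\<lambda>y. step_ratio (?s, a, y) * G (?s, a, y))"
  proof -
    have "(\<Sum>s'\<in>UNIV - {s\<^sub>0}. step_ratio (?s, a, Some s') * G (?s, a, Some s')) =
        (1 - p ?s a) / (1 - q ?s a) * (\<Sum>s'\<in>UNIV - {s\<^sub>0}. G (?s, a, Some s'))"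
      unfolding sum_distrib_left by (simp add: step_ratio_def)
    moreover have "step_ratio (?s, a, None) = p ?s a / q ?s a"
      by (simp add: step_ratio_def)
    ultimately show ?thesis
      unfolding P.expectation_trans Q.expectation_trans
      using Q.p_pos[of ?s a] Q.p_less_1[of ?s a] by simp
  qed
qed

lemma expectation_history_change:
  "measure_pmf.expectation (history P.M L s\<^sub>1 n) F =
    measure_pmf.expectation (history Q.M L s\<^sub>1 n) (\<lambda>h. likelihood_ratio h * F h)"
proof (induction n arbitrary: F)
  case (Suc n)
  show ?case
    unfolding expectation_history_Suc Suc expectation_next_step_change likelihood_ratio_snoc mult.assoc
    by simp
qed simp

text \<open>The relative entropy of two Bernoulli laws is at most their chi-squared divergence.\<close>

lemma expectation_ln_step_ratio_ge:
  assumes "\<And>s a. (p s a - q s a)\<^sup>2 / (p s a * (1 - p s a)) \<le> \<kappa> * c s a"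
  shows "- \<kappa> * measure_pmf.expectation (next_step Q.M L s\<^sub>1 h) (\<lambda>x. c (fst x) (fst (snd x))) \<le>
    measure_pmf.expectation (next_step Q.M L s\<^sub>1 h) (\<lambda>x. ln (step_ratio x))"
proof -
  have "0 \<le> measure_pmf.expectation (next_step Q.M L s\<^sub>1 h) (\<lambda>x. ln (step_ratio x) + \<kappa> * c (fst x) (fst (snd x)))"
  proof (rule expectation_next_step_ge)
    fix a
    let ?s = "state_after s\<^sub>1 h"
    define u v where "u = p ?s a" and "v = q ?s a"
    have u: "0 < u" "u < 1" and v: "0 < v" "v < 1"
      unfolding u_def v_def using P.p_pos P.p_less_1 Q.p_pos Q.p_less_1 by auto
    \<comment> \<open>Both bounds use \<open>ln x \<le> x - 1\<close> at the inverse ratio, which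
      puts the variance \<open>u * (1 - u)\<close> of the first law into the denominator.\<close>
    have 1: "1 - v / u \<le> ln (u / v)"
      using ln_le_minus_one[of "v / u"] u v by (simp add: ln_div)
    have 2: "1 - (1 - v) / (1 - u) \<le> ln ((1 - u) / (1 - v))"
      using ln_le_minus_one[of "(1 - v) / (1 - u)"] u v by (simp add: ln_div)
    have "- \<kappa> * c ?s a \<le> - ((u - v)\<^sup>2 / (u * (1 - u)))"
      using assms[of ?s a] unfolding u_def v_def by simp
    also have "\<dots> = v * (1 - v / u) + (1 - v) * (1 - (1 - v) / (1 - u))"
      using u by (simp add: divide_simps) (simp add: power2_eq_square algebra_simps)
    also have "\<dots> \<le> v * ln (u / v) + (1 - v) * ln ((1 - u) / (1 - v))"
      using 1 2 v by (intro add_mono mult_left_mono) auto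
    also have "\<dots> = measure_pmf.expectation (trans Q.M ?s a) (\<lambda>y. ln (step_ratio (?s, a, y)))"
      using Q.others_pos Q.two_states
      by (simp add: Q.expectation_trans step_ratio_def u_def v_def Q.others_def card_Diff_singleton)
    finally show "0 \<le> measure_pmf.expectation (trans Q.M ?s a)
        (\<lambda>y. ln (step_ratio (?s, a, y)) + \<kappa> * c (fst (?s, a, y)) (fst (snd (?s, a, y))))"
      by (simp add: Q.integrable_trans)
  qed
  then show ?thesis
    by (simp add: integrable_next_step)
qed

text \<open>The chain rule for relative entropy: the logarithm of the likelihood ratio is a sum over
  steps, and each conditional mean is bounded by what the current play reveals.\<close>

lemma expectation_ln_likelihood_ratio_ge:
  assumes "\<And>s a. (p s a - q s a)\<^sup>2 / (p s a * (1 - p s a)) \<le> \<kappa> * c s a"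
  shows "- \<kappa> * measure_pmf.expectation (history Q.M L s\<^sub>1 n) (path_sum (\<lambda>_ x. c (fst x) (fst (snd x)))) \<le>
    measure_pmf.expectation (history Q.M L s\<^sub>1 n) (\<lambda>h. ln (likelihood_ratio h))"
proof -
  have ln_eq: "ln (likelihood_ratio h) = path_sum (\<lambda>_ x. ln (step_ratio x)) h" for h
    by (induction h rule: rev_induct)
       (simp_all add: ln_mult_pos likelihood_ratio_pos step_ratio_pos)
  have "- \<kappa> * measure_pmf.expectation (history Q.M L s\<^sub>1 n) (path_sum (\<lambda>_ x. c (fst x) (fst (snd x)))) =
    (\<Sum>t<n. measure_pmf.expectation (history Q.M L s\<^sub>1 t) (\<lambda>h. - \<kappa> *
       measure_pmf.expectation (next_step Q.M L s\<^sub>1 h) (\<lambda>x. c (fst x) (fst (snd x)))))"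
    unfolding expectation_total sum_distrib_left by (simp add: integrable_history)
  also have "\<dots> \<le> measure_pmf.expectation (history Q.M L s\<^sub>1 n) (path_sum (\<lambda>_ x. ln (step_ratio x)))"
    unfolding expectation_total
    by (intro sum_mono expectation_history_mono expectation_ln_step_ratio_ge assms)
  finally show ?thesis
    unfolding ln_eq .
qed

text \<open>The pointwise inequality is averaged under \<open>Q\<close> with \<open>z\<close> the
  likelihood ratio: \<open>z\<close> has mean 1, \<open>z * N^2\<close> becomes a second moment
  under \<open>P\<close>, and the entropy is at most \<open>\<kappa>\<close> times the mean of
  \<open>N\<close>, since the instances differ at most in the pair of \<open>s\<close> and
  \<open>a\<close>.\<close>

lemma expectation_plays_change:
  assumes \<mu>: "\<mu> > 0"
    and \<kappa>: "\<And>s' a'. (p s' a' - q s' a')\<^sup>2 / (p s' a' * (1 - p s' a')) \<le> \<kappa> * of_bool (s' = s \<and> a' = a)"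
  shows "measure_pmf.expectation (history P.M L s\<^sub>1 n) (plays s a) \<le>
    (1 + \<mu> / 2 * \<kappa>) * measure_pmf.expectation (history Q.M L s\<^sub>1 n) (plays s a) +
    (measure_pmf.expectation (history P.M L s\<^sub>1 n) (\<lambda>h. (plays s a h)\<^sup>2) +
     measure_pmf.expectation (history Q.M L s\<^sub>1 n) (\<lambda>h. (plays s a h)\<^sup>2)) / \<mu>"
proof -
  let ?Q = "measure_pmf.expectation (history Q.M L s\<^sub>1 n)"
  let ?P = "measure_pmf.expectation (history P.M L s\<^sub>1 n)"
  let ?Z = likelihood_ratio
  have Z1: "?Q ?Z = 1"
    using expectation_history_change[of L s\<^sub>1 n "\<lambda>_. 1"] by simp
  have "?P (plays s a) - ?Q (plays s a) = ?Q (\<lambda>h. (?Z h - 1) * plays s a h)"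
    unfolding expectation_history_change by (simp add: integrable_history left_diff_distrib)
  also have "\<dots> \<le> ?Q (\<lambda>h. \<mu> / 2 * (?Z h - 1 - ln (?Z h)) + (?Z h * (plays s a h)\<^sup>2 + (plays s a h)\<^sup>2) / \<mu>)"
    using change_of_measure_pointwise[OF likelihood_ratio_pos \<mu>]
    by (intro expectation_history_mono) (simp add: distrib_right)
  also have "\<dots> = - (\<mu> / 2 * ?Q (\<lambda>h. ln (?Z h))) + (?P (\<lambda>h. (plays s a h)\<^sup>2) + ?Q (\<lambda>h. (plays s a h)\<^sup>2)) / \<mu>"
    unfolding expectation_history_change using Z1 by (simp add: integrable_history)
  also have "- (\<mu> / 2 * ?Q (\<lambda>h. ln (?Z h))) \<le> \<mu> / 2 * (\<kappa> * ?Q (plays s a))"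
    using mult_left_mono[OF expectation_ln_likelihood_ratio_ge[OF \<kappa>, of L s\<^sub>1 n], of "\<mu> / 2"] \<mu> by simp
  finally show ?thesis
    by (simp add: algebra_simps)
qed

end

section \<open>Averaging over the hidden special actions\<close>

lemma goals_take_le: "goals (take t h) \<le> goals h"
proof -
  have "goals h = goals (take t h) + goals (drop t h)"
    unfolding goals_def by (metis append_take_drop_id filter_append length_append)
  then show ?thesis
    by simp
qed

lemma sum_plays: "(\<Sum>a\<in>UNIV. plays s (a :: 'a :: finite) h) = visits s h"
proof (induction h rule: rev_induct)
  case (snoc x h)
  have "(\<Sum>a\<in>UNIV. of_bool (fst x = s \<and> fst (snd x) = a) :: real) = of_bool (fst x = s)"
    by (cases "fst x = s") (simp_all add: of_bool_def)
  with snoc show ?case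
    by (simp add: sum.distrib del: of_bool_conj)
qed simp

text \<open>Every step is of exactly one kind: played in \<open>s\<^sub>0\<close>, special
  elsewhere, or bad. Few steps of the first two kinds therefore force many bad ones.\<close>

lemma length_eq_visits_plays_bad:
  fixes f :: "'s::finite \<Rightarrow> 'a"
  shows "real (length h) = visits s\<^sub>0 h + (\<Sum>s\<in>UNIV - {s\<^sub>0}. plays s (f s) h) +
    path_sum (\<lambda>_ x. of_bool (fst x \<noteq> s\<^sub>0 \<and> fst (snd x) \<noteq> f (fst x))) h"
proof (induction h rule: rev_induct)
  case (snoc x h)
  have "(\<Sum>s\<in>UNIV - {s\<^sub>0}. of_bool (fst x = s \<and> fst (snd x) = f s) :: real) =
      (\<Sum>s\<in>UNIV - {s\<^sub>0}. if s = fst x then of_bool (fst (snd x) = f (fst x)) else 0)"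
    by (intro sum.cong) auto
  also have "\<dots> = of_bool (fst x \<noteq> s\<^sub>0 \<and> fst (snd x) = f (fst x))"
    by (subst sum.delta) auto
  finally show ?case
    using snoc by (simp add: sum.distrib del: of_bool_conj)
qed simp

text \<open>Steps are lost only if \<open>h\<close> has at least \<open>K\<close> goals; then
  \<open>goals h / K\<close> is at least 1 and pays for each of the at most \<open>length h\<close>
  lost steps. Only the mean of the goal count is then needed, no tail bound.\<close>

lemma path_sum_stopped_ge:
  assumes "\<And>x. 0 \<le> b x" "\<And>x. b x \<le> 1" and "K > 0"
  shows "path_sum (\<lambda>_. b) h - length h * real (goals h) / K \<le> path_sum (\<lambda>h x. of_bool (goals h < K) * b x) h"
proof -
  have "path_sum (\<lambda>_. b) h - path_sum (\<lambda>h x. of_bool (goals h < K) * b x) h =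
      (\<Sum>t<length h. of_bool (goals (take t h) \<ge> K) * b (h ! t))"
    unfolding path_sum_def sum_subtractf[symmetric] by (intro sum.cong) auto
  also have "\<dots> \<le> (\<Sum>t<length h. real (goals h) / K)"
  proof (rule sum_mono)
    fix t
    show "of_bool (goals (take t h) \<ge> K) * b (h ! t) \<le> real (goals h) / K"
    proof (cases "goals (take t h) \<ge> K")
      case True
      then have "1 \<le> real (goals h) / K"
        using goals_take_le[of t h] assms(3) by simp
      then show ?thesis
        using assms(2)[of "h ! t"] True by simp
    qed simp
  qed
  finally show ?thesis
    by (simp add: algebra_simps)
qed

text \<open>Averaging over all \<open>f\<close>, the value \<open>f s\<close> may be resampled: \<open>(f, a) \<mapsto> (f(s := a), f s)\<close> is an involution.\<close>

lemma sum_fun_upd: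
  fixes g :: "('s::finite \<Rightarrow> 'a::finite) \<Rightarrow> real"
  shows "(\<Sum>f\<in>UNIV. \<Sum>a\<in>UNIV. g (f(s := a))) = CARD('a) * (\<Sum>f\<in>UNIV. g f)"
proof -
  let ?i = "\<lambda>(f :: 's \<Rightarrow> 'a, a). (f(s := a), f s)"
  have "bij ?i"
    by (rule involuntory_imp_bij) auto
  then have "(\<Sum>fa\<in>UNIV. g (fst (?i fa))) = (\<Sum>fa\<in>(UNIV :: (('s \<Rightarrow> 'a) \<times> 'a) set). g (fst fa))"
    by (rule sum.reindex_bij_betw[of ?i UNIV UNIV "\<lambda>fa. g (fst fa)"])
  moreover have "(\<Sum>fa\<in>UNIV. F fa) = (\<Sum>f\<in>UNIV. \<Sum>a\<in>UNIV. F (f, a))"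
    for F :: "('s \<Rightarrow> 'a) \<times> 'a \<Rightarrow> real"
    by (simp add: sum.cartesian_product)
  ultimately show ?thesis
    by (simp add: sum_distrib_left)
qed

text \<open>\<open>None\<close> encodes a state without special action, as in the comparison
  instances. The hard instances are those with \<open>g = Some \<circ> f\<close>.\<close>

definition goal_prob :: "real \<Rightarrow> real \<Rightarrow> 's \<Rightarrow> ('s \<Rightarrow> 'a option) \<Rightarrow> 's \<Rightarrow> 'a \<Rightarrow> real" where
  "goal_prob B \<delta> s\<^sub>0 g s a = (if s = s\<^sub>0 \<or> g s = Some a then 1 / B else (1 - \<delta>) / B)"

locale hard_instances =
  fixes B \<delta> :: real and s\<^sub>0 :: "'s::finite" and L :: "('s, 'a::finite) learner"
  assumes B: "B \<ge> 2" and \<delta>: "0 \<le> \<delta>" "\<delta> < 1" and two_states: "CARD('s) \<ge> 2"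
begin

lemma restart_goal_prob: "restart (goal_prob B \<delta> s\<^sub>0 (g :: 's \<Rightarrow> 'a option))"
proof
  show "0 < goal_prob B \<delta> s\<^sub>0 g s a" for s a
    using B \<delta> by (simp add: goal_prob_def)
  have "(1 - \<delta>) / B < 1" "1 / B < 1"
    using B \<delta> by (simp_all add: divide_less_eq)
  then show "goal_prob B \<delta> s\<^sub>0 g s a < 1" for s a
    by (simp add: goal_prob_def)
qed (rule two_states)

abbreviation "\<E> g n \<equiv> measure_pmf.expectation (history (restart_ssp (goal_prob B \<delta> s\<^sub>0 g) s\<^sub>0) L s\<^sub>0 n)"

definition "w = 1 - (1 - \<delta>) / B"

lemma goal_prob_le: "goal_prob B \<delta> s\<^sub>0 g s a \<le> 1 / B"
  using B \<delta> by (simp add: goal_prob_def divide_right_mono)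

lemma one_minus_goal_prob_le: "1 - goal_prob B \<delta> s\<^sub>0 g s a \<le> w"
  using B \<delta> by (simp add: goal_prob_def w_def divide_right_mono)

text \<open>The expected goal count is at most \<open>T / B\<close>. Together with 1 for the start
  it bounds the visits to \<open>s\<^sub>0\<close>, and \<open>T / K\<close> times it bounds what is
  lost by stopping at the \<open>K\<close>-th goal.\<close>

lemma expected_bad_plays_ge:
  fixes T :: nat
  assumes "K > 0"
  shows "real T - 1 - T / B - (real T)\<^sup>2 / (B * K) - (\<Sum>s\<in>UNIV - {s\<^sub>0}. \<E> (Some \<circ> f) T (plays s (f s))) \<le>
    \<E> (Some \<circ> f) T (path_sum (\<lambda>h x. of_bool (goals h < K) * of_bool (fst x \<noteq> s\<^sub>0 \<and> fst (snd x) \<noteq> f (fst x))))"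
    (is "_ \<le> \<E> ?g T (path_sum ?b)")
proof -
  interpret restart "goal_prob B \<delta> s\<^sub>0 ?g" s\<^sub>0
    by (rule restart_goal_prob)
  let ?X = "\<lambda>h. real T - 1 - real (goals h) - (\<Sum>s\<in>UNIV - {s\<^sub>0}. plays s (f s) h) - T * real (goals h) / K"
  have "\<E> ?g T ?X \<le> \<E> ?g T (path_sum ?b)"
  proof (rule expectation_history_mono)
    fix h assume h: "h \<in> set_pmf (history M L s\<^sub>0 T)"
    have "visits s\<^sub>0 h \<le> 1 + real (goals h)"
      using visits_init[OF h] by (simp add: of_bool_def split: if_splits)
    then show "?X h \<le> path_sum ?b h"
      using length_eq_visits_plays_bad[of h s\<^sub>0 f] length_history[OF h]
        path_sum_stopped_ge[of "\<lambda>x. of_bool (fst x \<noteq> s\<^sub>0 \<and> fst (snd x) \<noteq> f (fst x))" K h] assms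
      by simp
  qed
  moreover have "\<E> ?g T ?X = real T - 1 - (1 + T / K) * \<E> ?g T (\<lambda>h. real (goals h)) - (\<Sum>s\<in>UNIV - {s\<^sub>0}. \<E> ?g T (plays s (f s)))"
    by (simp add: integrable_history algebra_simps)
  moreover have "(1 + T / K) * \<E> ?g T (\<lambda>h. real (goals h)) \<le> (1 + T / K) * (T * (1 / B))"
    using goal_prob_le by (intro mult_left_mono expectation_goals_le) auto
  moreover have "(1 + T / K) * (T * (1 / B)) = T / B + (real T)\<^sup>2 / (B * K)"
    using B assms by (simp add: field_simps power2_eq_square)
  ultimately show ?thesis
    by simp
qed

text \<open>Along each history plays are at most visits and visits at most entries, and the moments
  of the entries have the same bound for every \<open>g\<close>, hence under both laws of a
  comparison.\<close>

lemma expectation_plays_square_le: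
  assumes "s \<noteq> s\<^sub>0"
  shows "\<E> g T (\<lambda>h. (plays s a h)\<^sup>2) \<le> T * (w / (CARD('s) - 1)) + (T * (w / (CARD('s) - 1)))\<^sup>2"
proof -
  interpret restart "goal_prob B \<delta> s\<^sub>0 g" s\<^sub>0
    by (rule restart_goal_prob)
  have "\<E> g T (\<lambda>h. (plays s a h)\<^sup>2) \<le> \<E> g T (\<lambda>h. (entries s h)\<^sup>2)"
  proof (intro expectation_history_mono power_mono)
    fix h assume h: "h \<in> set_pmf (history M L s\<^sub>0 T)"
    have "plays s a h \<le> visits s h"
      by (rule path_sum_mono) simp
    also have "\<dots> \<le> entries s h"
      using visits_eq_entries[OF assms h] by (simp add: of_bool_def split: if_splits)
    finally show "plays s a h \<le> entries s h" .
  qed (rule path_sum_nonneg, simp)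
  also have "\<dots> \<le> T * (w / others) + (T * (w / others))\<^sup>2"
    by (rule entries_moments(2)[OF one_minus_goal_prob_le assms])
  finally show ?thesis
    using two_states by (simp add: others_def of_nat_diff)
qed

text \<open>All \<open>a\<close> are compared with one instance \<open>g0\<close> that has no
  special action in \<open>s\<close>. Its law does not depend on \<open>a\<close>, so its plays over
  all \<open>a\<close> add up to the visits of \<open>s\<close>, with mean at most \<open>r\<close>
  instead of \<open>CARD('a) * r\<close>.\<close>

lemma sum_expectation_special_plays_le:
  fixes f :: "'s \<Rightarrow> 'a" and T :: nat
  assumes s: "s \<noteq> s\<^sub>0" and \<mu>: "\<mu> > 0"
  defines "r \<equiv> T * (w / (CARD('s) - 1))"
  shows "(\<Sum>a\<in>UNIV. \<E> (Some \<circ> f(s := a)) T (plays s a)) \<le>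
    (1 + \<mu> / 2 * (\<delta>\<^sup>2 / (B - 1))) * r + CARD('a) * (2 * (r + r\<^sup>2) / \<mu>)"
proof -
  let ?\<kappa> = "\<delta>\<^sup>2 / (B - 1)"
  let ?g = "\<lambda>a. Some \<circ> f(s := a)"
  define g0 where "g0 = (Some \<circ> f)(s := None)"
  interpret Q: restart "goal_prob B \<delta> s\<^sub>0 g0" s\<^sub>0
    by (rule restart_goal_prob)
  have "\<E> (?g a) T (plays s a) \<le> (1 + \<mu> / 2 * ?\<kappa>) * \<E> g0 T (plays s a) + 2 * (r + r\<^sup>2) / \<mu>" for a
  proof -
    interpret change_of_ssp "goal_prob B \<delta> s\<^sub>0 (?g a)" "goal_prob B \<delta> s\<^sub>0 g0" s\<^sub>0
      unfolding change_of_ssp_def by (intro conjI restart_goal_prob)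
    \<comment> \<open>A gap of \<open>\<delta> / B\<close> against the variance of a Bernoulli law
      with mean \<open>1 / B\<close> gives the divergence
      \<open>\<delta>^2 / (B - 1)\<close>.\<close>
    have "1 / B * (1 - 1 / B) = (B - 1) / B\<^sup>2"
      using B by (simp add: field_simps power2_eq_square)
    moreover have "(1 / B - (1 - \<delta>) / B)\<^sup>2 = \<delta>\<^sup>2 / B\<^sup>2"
      using B by (simp add: diff_divide_distrib power_divide)
    ultimately have "(1 / B - (1 - \<delta>) / B)\<^sup>2 / (1 / B * (1 - 1 / B)) \<le> ?\<kappa>"
      using B by simp
    then have "(goal_prob B \<delta> s\<^sub>0 (?g a) s' a' - goal_prob B \<delta> s\<^sub>0 g0 s' a')\<^sup>2 /
        (goal_prob B \<delta> s\<^sub>0 (?g a) s' a' * (1 - goal_prob B \<delta> s\<^sub>0 (?g a) s' a')) \<le> ?\<kappa> * of_bool (s' = s \<and> a' = a)" for s' a'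
      using s by (cases "s' = s \<and> a' = a") (auto simp: goal_prob_def g0_def)
    from expectation_plays_change[OF \<mu> this, of L s\<^sub>0 T]
    have "\<E> (?g a) T (plays s a) \<le> (1 + \<mu> / 2 * ?\<kappa>) * \<E> g0 T (plays s a) +
        (\<E> (?g a) T (\<lambda>h. (plays s a h)\<^sup>2) + \<E> g0 T (\<lambda>h. (plays s a h)\<^sup>2)) / \<mu>" .
    also have "\<dots> \<le> (1 + \<mu> / 2 * ?\<kappa>) * \<E> g0 T (plays s a) + ((r + r\<^sup>2) + (r + r\<^sup>2)) / \<mu>"
      unfolding r_def using \<mu> expectation_plays_square_le[OF s]
      by (intro add_left_mono divide_right_mono add_mono) auto
    finally show ?thesis
      by simp
  qed
  then have "(\<Sum>a\<in>UNIV. \<E> (?g a) T (plays s a)) \<le>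
      (\<Sum>a\<in>UNIV. (1 + \<mu> / 2 * ?\<kappa>) * \<E> g0 T (plays s a) + 2 * (r + r\<^sup>2) / \<mu>)"
    by (rule sum_mono)
  also have "\<dots> = (1 + \<mu> / 2 * ?\<kappa>) * \<E> g0 T (visits s) + CARD('a) * (2 * (r + r\<^sup>2) / \<mu>)"
    unfolding sum_plays[symmetric, abs_def]
    by (simp add: sum.distrib sum_distrib_left integrable_history)
  also have "\<E> g0 T (visits s) \<le> r"
  proof -
    have "\<E> g0 T (visits s) \<le> \<E> g0 T (entries s)"
    proof (intro expectation_history_mono)
      fix h assume "h \<in> set_pmf (history Q.M L s\<^sub>0 T)"
      from Q.visits_eq_entries[OF s this] show "visits s h \<le> entries s h"
        by (simp add: of_bool_def split: if_splits)
    qed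
    also have "\<dots> \<le> T * (w / Q.others)"
      by (rule Q.entries_moments(1)[OF one_minus_goal_prob_le s])
    finally show ?thesis
      using two_states by (simp add: r_def Q.others_def of_nat_diff)
  qed
  finally show ?thesis
    using \<mu> B by (simp add: mult_left_mono)
qed

text \<open>If every \<open>f\<close> exceeded the bound, so would the sum over all
  \<open>f\<close>. Resampling \<open>f s\<close> turns the contribution of each state into an
  average over its special action, which \<open>sum_expectation_special_plays_le\<close>
  bounds.\<close>

lemma ex_few_special_plays:
  fixes T :: nat
  assumes \<mu>: "\<mu> > 0"
  defines "r \<equiv> T * (w / (CARD('s) - 1))"
  shows "\<exists>f :: 's \<Rightarrow> 'a. (\<Sum>s\<in>UNIV - {s\<^sub>0}. \<E> (Some \<circ> f) T (plays s (f s))) \<le>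
    (CARD('s) - 1) * ((1 + \<mu> / 2 * (\<delta>\<^sup>2 / (B - 1))) * r / CARD('a) + 2 * (r + r\<^sup>2) / \<mu>)"
    (is "\<exists>f. ?X f \<le> _ * ?c")
proof (rule ccontr)
  let ?F = "UNIV :: ('s \<Rightarrow> 'a) set"
  let ?N = "real (CARD('s) - 1)"
  assume "\<not> ?thesis"
  then have "(\<Sum>f\<in>?F. ?N * ?c) < (\<Sum>f\<in>?F. ?X f)"
    by (intro sum_strict_mono) (auto simp: not_le)
  also have "\<dots> = (\<Sum>s\<in>UNIV - {s\<^sub>0}. \<Sum>f\<in>?F. \<E> (Some \<circ> f) T (plays s (f s)))"
    by (rule sum.swap)
  also have "\<dots> \<le> (\<Sum>s\<in>UNIV - {s\<^sub>0}. card ?F * ?c)"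
  proof (rule sum_mono)
    fix s assume "s \<in> UNIV - {s\<^sub>0}"
    then have s: "s \<noteq> s\<^sub>0" by simp
    have "CARD('a) * (\<Sum>f\<in>?F. \<E> (Some \<circ> f) T (plays s (f s))) =
        (\<Sum>f\<in>?F. \<Sum>a\<in>UNIV. \<E> (Some \<circ> f(s := a)) T (plays s a))"
      unfolding sum_fun_upd[symmetric, of _ s] by simp
    also have "\<dots> \<le> (\<Sum>f\<in>?F. CARD('a) * ?c)"
      using sum_expectation_special_plays_le[OF s \<mu>, of _ T]
      by (intro sum_mono) (simp add: r_def distrib_left)
    finally show "(\<Sum>f\<in>?F. \<E> (Some \<circ> f) T (plays s (f s))) \<le> card ?F * ?c"
      by (simp add: mult.left_commute)
  qed
  also have "\<dots> = (\<Sum>f\<in>?F. ?N * ?c)"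
    by (simp add: card_Diff_singleton)
  finally show False
    by simp
qed

end

section \<open>Choice of the constants and the lower bound\<close>

lemma regret_bound_arithmetic:
  fixes S A B K T \<delta> w :: real
  assumes S: "S \<ge> 2" and A: "A \<ge> 16" and B: "B \<ge> 2" and K: "S * A \<le> K"
    and T: "K * B / 9 \<le> T" "T \<le> K * B / 8" "8 \<le> T"
    and \<delta>: "\<delta> = sqrt (S * A / K) / 8"
    and w: "w = 1 - (1 - \<delta>) / B" and r: "r = T * (w / (S - 1))"
  shows "B * sqrt (S * A * K) / 1024 \<le>
    \<delta> * (T - 1 - T / B - T\<^sup>2 / (B * K) -
      (S - 1) * ((1 + 32 * r / 2 * (\<delta>\<^sup>2 / (B - 1))) * r / A + 2 * (r + r\<^sup>2) / (32 * r)))"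
proof -
  define \<beta> where "\<beta> = 1 - 1 / B"
  have SA: "S * A > 0" "S * 16 \<le> S * A"
    using S A by auto
  then have K0: "K > 0" "S \<le> K / 16"
    using K by linarith+
  have SAK: "S * A / K \<le> 1" "0 \<le> S * A / K"
    using K K0 SA by auto
  have \<delta>01: "0 \<le> \<delta>" "\<delta> \<le> 1 / 8"
    using SAK real_sqrt_le_1_iff[of "S * A / K"] by (auto simp: \<delta>)
  have \<delta>2: "\<delta>\<^sup>2 = S * A / (64 * K)"
    using SAK by (simp add: \<delta> power_divide)
  have sqrt_eq: "sqrt (S * A * K) = 8 * \<delta> * K"
    using K0 by (simp add: \<delta> real_sqrt_mult real_sqrt_divide real_div_sqrt field_simps)
  have \<beta>: "1 / 2 \<le> \<beta>" "B * \<beta> = B - 1"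
    using B by (auto simp: \<beta>_def field_simps)
  have w_eq: "w = \<beta> + \<delta> / B"
    using B by (simp add: w \<beta>_def diff_divide_distrib)
  have "\<delta> / B \<le> 1 / 8 / 2"
    using \<delta>01 B by (intro frac_le) auto
  then have w\<beta>: "w \<le> 9 / 8 * \<beta>"
    using w_eq \<beta> by simp
  have w0: "0 < w"
    using w_eq \<beta> \<delta>01 B by (simp add: add_pos_nonneg)
  have S1: "S - 1 > 0" "S / 2 \<le> S - 1"
    using S by auto
  have r0: "r > 0" "(S - 1) * r = T * w"
    using S1 w0 T by (auto simp: r)
  \<comment> \<open>The contribution of information to the share of special plays. The factor
    \<open>B\<close> of \<open>T \<le> K * B / 8\<close> is absorbed by
    \<open>B * \<beta> = B - 1\<close>, and \<open>S\<close> by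
    \<open>S \<le> 2 * (S - 1)\<close>.\<close>
  have gain: "16 * r * (\<delta>\<^sup>2 / (B - 1)) / A \<le> 9 / 128"
  proof -
    have "w * T * S \<le> (9 / 8 * \<beta>) * (K * B / 8) * (2 * (S - 1))"
      using w\<beta> T w0 S1 \<beta> S K0 B by (intro mult_mono) auto
    then have "16 * (w * T * S) \<le> 9 / 2 * (K * (S - 1)) * (B * \<beta>)"
      by (simp add: algebra_simps)
    then have "16 * (w * T * S) \<le> 9 / 2 * (K * (S - 1)) * (B - 1)"
      unfolding \<beta>(2) .
    then have "16 * (w * T * S) / (64 * K * (S - 1) * (B - 1)) \<le> 9 / 128"
    proof (subst pos_divide_le_eq)
      show "0 < 64 * K * (S - 1) * (B - 1)"
        using K0 S1 B by (intro mult_pos_pos) auto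
    qed (simp add: algebra_simps)
    moreover have "16 * r * (\<delta>\<^sup>2 / (B - 1)) / A = 16 * (w * T * S) / (64 * K * (S - 1) * (B - 1))"
      unfolding \<delta>2 r using A by simp
    ultimately show ?thesis
      by simp
  qed
  have "(S - 1) * ((1 + 32 * r / 2 * (\<delta>\<^sup>2 / (B - 1))) * r / A + 2 * (r + r\<^sup>2) / (32 * r)) =
      T * w * (1 / A + 16 * r * (\<delta>\<^sup>2 / (B - 1)) / A) + ((S - 1) + T * w) / 16"
  proof -
    \<comment> \<open>With \<open>\<mu> = 32 * r\<close> the second moments cost only a sixteenth of
      \<open>r\<close>, plus a constant per state.\<close>
    have 1: "2 * (r + r\<^sup>2) / (32 * r) = (1 + r) / 16"
      using r0 by (simp add: field_simps power2_eq_square)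
    have 2: "(S - 1) * ((1 + x) * r / A) = ((S - 1) * r) * (1 / A + x / A)" for x
      using A by (simp add: field_simps)
    have 3: "(S - 1) * ((1 + r) / 16) = ((S - 1) + (S - 1) * r) / 16"
      by (simp add: field_simps)
    show ?thesis
      unfolding r0(2)[symmetric] distrib_left[of "S - 1"] 1 2 3 by simp
  qed
  also have "\<dots> \<le> T * w * (1 / 16 + 9 / 128) + ((S - 1) + T * w) / 16"
    using gain A T w0 by (intro add_right_mono mult_left_mono add_mono) (auto simp: frac_le)
  also have "\<dots> = 25 / 128 * (T * w) + (S - 1) / 16"
    by (simp add: field_simps)
  also have "\<dots> \<le> 25 / 128 * (T * (9 / 8 * \<beta>)) + 9 / 512 * T"
  proof -
    \<comment> \<open>This uses \<open>B \<ge> 2\<close>. With \<open>S \<le> K / 16\<close>, which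
      comes from \<open>A \<ge> 16\<close>, the constants of all states add up to a small fraction
      of \<open>T\<close>.\<close>
    have "K * 2 / 9 \<le> T"
      using T(1) mult_left_mono[OF B, of K] K0 by linarith
    then have "(S - 1) / 16 \<le> 9 / 512 * T"
      using K0(2) by simp
    moreover have "25 / 128 * (T * w) \<le> 25 / 128 * (T * (9 / 8 * \<beta>))"
      using T w\<beta> by (intro mult_left_mono) auto
    ultimately show ?thesis
      by (intro add_mono)
  qed
  finally have few: "(S - 1) * ((1 + 32 * r / 2 * (\<delta>\<^sup>2 / (B - 1))) * r / A + 2 * (r + r\<^sup>2) / (32 * r)) \<le>
    225 / 1024 * (T * \<beta>) + 9 / 512 * T" by simp
  have "T * T \<le> T * (K * B / 8)"
    using T by (intro mult_left_mono) auto
  then have Tsq: "T\<^sup>2 / (B * K) \<le> T / 8"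
    using B K0 by (subst pos_divide_le_eq) (auto simp: power2_eq_square algebra_simps)
  have T\<beta>: "T - T / B = T * \<beta>" "T / 2 \<le> T * \<beta>"
    using \<beta> T mult_left_mono[OF \<beta>(1), of T] by (auto simp: \<beta>_def algebra_simps)
  \<comment> \<open>As \<open>sqrt (S * A * K) = 8 * \<delta> * K\<close>, the target is exactly
    \<open>\<delta> * (B * K / 128)\<close>.\<close>
  have "B * K / 128 \<le> T - 1 - T / B - T\<^sup>2 / (B * K) -
      (S - 1) * ((1 + 32 * r / 2 * (\<delta>\<^sup>2 / (B - 1))) * r / A + 2 * (r + r\<^sup>2) / (32 * r))"
  proof -
    have "B * K / 9 \<le> T"
      using T(1) by (simp only: mult.commute)
    then show ?thesis
      using few Tsq T\<beta> T(3) by linarith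
  qed
  from mult_left_mono[OF this \<delta>01(1)] show ?thesis
    unfolding sqrt_eq by (simp add: algebra_simps)
qed

theorem theorem2p7:
  fixes B :: real
    and K :: nat
    and s_init :: "'s::finite"
    and L :: "('s, 'a::finite) learner"
  assumes "CARD('s) \<ge> 2"
    and "CARD('a) \<ge> 16"
    and "B \<ge> 2"
    and "K \<ge> CARD('s) * CARD('a)"
  shows "\<exists>(M :: ('s, 'a) ssp) \<pi>s.
           ssp_instance M \<and> init M = s_init \<and> (\<forall>s a. cost M s a = 1) \<and>
           optimal_proper_policy M \<pi>s \<and> (\<forall>s. cost_to_go M \<pi>s s \<le> ennreal B) \<and>
           expected_regret M \<pi>s L K
             \<ge> ereal (1 / 1024 * B * sqrt (real CARD('s) * real CARD('a) * real K))"
proof -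
  let ?S = "real CARD('s)" and ?A = "real CARD('a)"
  have SAK: "?S * ?A \<le> real K"
    using assms(4) by (metis of_nat_le_iff of_nat_mult)
  have "2 * 16 \<le> ?S * ?A"
    using assms(1,2) by (intro mult_mono) auto
  then have K32: "32 \<le> real K"
    using SAK by linarith
  \<comment> \<open>At this gap an even share of \<open>K * B / 8\<close> steps per state-action
    pair yields only a small constant amount of information.\<close>
  define \<delta> where "\<delta> = sqrt (?S * ?A / K) / 8"
  \<comment> \<open>At most \<open>T / B \<le> K / 8\<close> goals are expected in this time, so
    stopping at the \<open>K\<close>-th goal loses at most an eighth of the steps in
    expectation.\<close>
  define T where "T = nat \<lfloor>K * B / 8\<rfloor>"
  have "sqrt (?S * ?A / K) < 8"
    using SAK K32 by (intro real_less_lsqrt) (auto simp: divide_less_eq)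
  then have \<delta>: "0 \<le> \<delta>" "\<delta> < 1"
    unfolding \<delta>_def by simp_all
  interpret hard_instances B \<delta> s_init L
    by unfold_locales (use assms \<delta> in auto)
  have "32 * 2 \<le> K * B"
    using K32 assms(3) by (intro mult_mono) auto
  then have "8 \<le> \<lfloor>K * B / 8\<rfloor>"
    by (simp add: le_floor_iff)
  \<comment> \<open>Rounding down costs less than one step; with \<open>T \<ge> 8\<close> this still
    gives \<open>K * B \<le> 9 * T\<close>.\<close>
  then have T: "8 \<le> real T" "real T \<le> K * B / 8" "K * B / 8 < real T + 1"
    unfolding T_def by linarith+
  define r where "r = T * (w / (CARD('s) - 1))"
  have r_eq: "r = T * (w / (?S - 1))"
    using assms(1) by (simp add: r_def of_nat_diff)
  have "w > 0"
    using \<delta> assms(3) by (simp add: w_def field_simps)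
  then have "r > 0"
    using T assms(1) by (simp add: r_eq)
  \<comment> \<open>The hidden actions may depend on \<open>L\<close>, since the learner is fixed
    before the instance is chosen.\<close>
  then obtain f :: "'s \<Rightarrow> 'a" where f: "(\<Sum>s\<in>UNIV - {s_init}. \<E> (Some \<circ> f) T (plays s (f s))) \<le>
    (?S - 1) * ((1 + 32 * r / 2 * (\<delta>\<^sup>2 / (B - 1))) * r / ?A + 2 * (r + r\<^sup>2) / (32 * r))"
    using ex_few_special_plays[of "32 * r" T] assms(1) unfolding r_def[symmetric] by (auto simp: of_nat_diff)
  let ?p = "goal_prob B \<delta> s_init (Some \<circ> f)"
  interpret restart ?p s_init
    by (rule restart_goal_prob)
  have B1: "B > 1"
    using assms(3) by simp
  have opt: "?p s (f s) = 1 / B" for s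
    by (simp add: goal_prob_def)
  have cost_le: "cost_to_go M f s \<le> ennreal B" for s
    by (rule cost_to_go_le[OF opt B1])
  have cost_eq: "cost_to_go M f s_init = ennreal B"
    by (intro antisym cost_le cost_to_go_ge[OF goal_prob_le B1])
  let ?bad = "\<lambda>s a. of_bool (s \<noteq> s_init \<and> a \<noteq> f s) :: real"
  have gap: "1 - B * ?p s a = \<delta> * ?bad s a" for s a
    using B1 by (auto simp: goal_prob_def)
  have "B * sqrt (?S * ?A * K) / 1024 \<le> \<delta> * (real T - 1 - T / B - (real T)\<^sup>2 / (B * K) -
      (?S - 1) * ((1 + 32 * r / 2 * (\<delta>\<^sup>2 / (B - 1))) * r / ?A + 2 * (r + r\<^sup>2) / (32 * r)))"
    using assms(1-3) SAK T by (intro regret_bound_arithmetic[where w = w and r = r] \<delta>_def w_def r_eq) auto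
  also have "\<dots> \<le> \<delta> * (real T - 1 - T / B - (real T)\<^sup>2 / (B * K) - (\<Sum>s\<in>UNIV - {s_init}. \<E> (Some \<circ> f) T (plays s (f s))))"
    using f \<delta>(1) by (intro mult_left_mono) auto
  also have "\<dots> \<le> \<delta> * \<E> (Some \<circ> f) T (path_sum (\<lambda>h x. of_bool (goals h < K) * ?bad (fst x) (fst (snd x))))"
    using K32 by (intro mult_left_mono expected_bad_plays_ge \<delta>) auto
  finally have "ereal (1 / 1024 * B * sqrt (?S * ?A * K)) \<le>
      ereal (\<delta> * \<E> (Some \<circ> f) T (path_sum (\<lambda>h x. of_bool (goals h < K) * ?bad (fst x) (fst (snd x)))))"
    by simp
  also have "\<dots> \<le> expected_regret M f L K"
    using B1 by (intro expected_regret_ge_bad[OF gap _ \<delta>(1) cost_eq]) auto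
  finally have "expected_regret M f L K \<ge> ereal (1 / 1024 * B * sqrt (?S * ?A * K))" .
  moreover have "ssp_instance M"
    unfolding ssp_instance_def using proper_restart by auto
  moreover have "optimal_proper_policy M f"
    by (rule optimal_proper_restart[OF goal_prob_le opt B1])
  ultimately show ?thesis
    using cost_le by (intro exI[of _ M] exI[of _ f]) simp
qed

end
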